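(* Let $\varphi:\mathfrak{g}\to\mathfrak{q}$ be a homomorphism of Leibniz algebras over $\mathbb{K}$ such that the induced map $\varphi_{\mathrm{Lie}}:\mathfrak{g}_{\mathrm{Lie}}\to\mathfrak{q}_{\mathrm{Lie}}$ is an isomorphism and the induced homomorphism $HL^{\mathrm{Lie}}_2(\mathfrak{g})\to HL^{\mathrm{Lie}}_2(\mathfrak{q})$ is an epimorphism. If $\mathfrak{g}$ and $\mathfrak{q}$ are $\mathrm{Lie}$-nilpotent Leibniz algebras, then $\varphi$ is an isomorphism.
   Context: $\mathbb{K}$ is a field with $\frac12\in\mathbb{K}$. A Leibniz algebra is a $\mathbb{K}$-vector space with a bilinear bracket satisfying $[x,[y,z]]=[[x,y],z]-[[x,z],y]$. $\mathfrak{q}^{\mathrm{ann}}$ is the span of all $[x,x]$, $x\in\mathfrak{q}$ (a two-sided ideal), $\mathfrak{q}_{\mathrm{Lie}}=\mathfrak{q}/\mathfrak{q}^{\mathrm{ann}}$. For two-sided ideals $\mathfrak{m},\mathfrak{n}$ of $\mathfrak{q}$, $[\mathfrak{m},\mathfrak{n}]_{\mathrm{Lie}}$ is the span of all $[m,n]+[n,m]$, $m\in\mathfrak{m}$, $n\in\mathfrak{n}$ (a two-sided ideal). $\mathfrak{q}$ is $\mathrm{Lie}$-nilpotent if there is a finite chain $0=\mathfrak{m}_0\trianglelefteq\mathfrak{m}_1\trianglelefteq\dots\trianglelefteq\mathfrak{m}_k=\mathfrak{q}$ of two-sided ideals of $\mathfrak{q}$ with $[\mathfrak{m}_i,\mathfrak{q}]_{\mathrm{Lie}}\subseteq\mathfrak{m}_{i-1}$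 for $1\le i\le k$. $HL^{\mathrm{Lie}}_2(\mathfrak{q})=(\mathfrak{r}\cap[\mathfrak{f},\mathfrak{f}]_{\mathrm{Lie}})/[\mathfrak{r},\mathfrak{f}]_{\mathrm{Lie}}$ for any free presentation $0\to\mathfrak{r}\to\mathfrak{f}\to\mathfrak{q}\to0$ ($\mathfrak{f}$ a free Leibniz algebra); this is independent of the presentation up to canonical isomorphism and functorial in $\mathfrak{q}$ (lift a homomorphism to the free presentations). *)

theory Defs
  imports "HOL-Algebra.Module" "HOL-Algebra.QuotRing"
begin

text \<open>
  Algebras over \<open>K\<close> are carried by the \<open>module\<close> record: \<open>\<otimes>\<^bsub>Q\<^esub>\<close> is the bracket and the \<open>one\<close>
  field plays no role.
\<close>

locale leibniz_algebra = field K + module K Q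
  for K :: "('k, 'r) ring_scheme" and Q :: "('k, 'a, 'm) module_scheme" (structure) +
  assumes bracket_closed:
      "\<lbrakk>x \<in> carrier Q; y \<in> carrier Q\<rbrakk> \<Longrightarrow> x \<otimes> y \<in> carrier Q"
    and bracket_l_distr:
      "\<lbrakk>x \<in> carrier Q; y \<in> carrier Q; z \<in> carrier Q\<rbrakk> \<Longrightarrow> (x \<oplus> y) \<otimes> z = (x \<otimes> z) \<oplus> (y \<otimes> z)"
    and bracket_r_distr:
      "\<lbrakk>x \<in> carrier Q; y \<in> carrier Q; z \<in> carrier Q\<rbrakk> \<Longrightarrow> x \<otimes> (y \<oplus> z) = (x \<otimes> y) \<oplus> (x \<otimes> z)"
    and bracket_smult_l:
      "\<lbrakk>a \<in> carrier K; x \<in> carrier Q; y \<in> carrier Q\<rbrakk> \<Longrightarrow> (a \<odot> x) \<otimes> y = a \<odot> (x \<otimes> y)"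
    and bracket_smult_r:
      "\<lbrakk>a \<in> carrier K; x \<in> carrier Q; y \<in> carrier Q\<rbrakk> \<Longrightarrow> x \<otimes> (a \<odot> y) = a \<odot> (x \<otimes> y)"
    and leibniz_identity:
      "\<lbrakk>x \<in> carrier Q; y \<in> carrier Q; z \<in> carrier Q\<rbrakk> \<Longrightarrow>
        x \<otimes> (y \<otimes> z) = ((x \<otimes> y) \<otimes> z) \<ominus> ((x \<otimes> z) \<otimes> y)"

definition leibniz_hom ::
  "('k, 'r) ring_scheme \<Rightarrow> ('k, 'a, 'm) module_scheme \<Rightarrow> ('k, 'b, 'n) module_scheme \<Rightarrow> ('a \<Rightarrow> 'b) set"
where
  "leibniz_hom K P Q = {h. h \<in> carrier P \<rightarrow> carrier Q \<and>
     (\<forall>x\<in>carrier P. \<forall>y\<in>carrier P. h (x \<oplus>\<^bsub>P\<^esub> y) = h x \<oplus>\<^bsub>Q\<^esub> h y) \<and>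
     (\<forall>a\<in>carrier K. \<forall>x\<in>carrier P. h (a \<odot>\<^bsub>P\<^esub> x) = a \<odot>\<^bsub>Q\<^esub> h x) \<and>
     (\<forall>x\<in>carrier P. \<forall>y\<in>carrier P. h (x \<otimes>\<^bsub>P\<^esub> y) = h x \<otimes>\<^bsub>Q\<^esub> h y)}"

definition leibniz_epi ::
  "('k, 'r) ring_scheme \<Rightarrow> ('k, 'a, 'm) module_scheme \<Rightarrow> ('k, 'b, 'n) module_scheme \<Rightarrow> ('a \<Rightarrow> 'b) set"
where
  "leibniz_epi K P Q = {h \<in> leibniz_hom K P Q. h ` carrier P = carrier Q}"

definition leibniz_iso ::
  "('k, 'r) ring_scheme \<Rightarrow> ('k, 'a, 'm) module_scheme \<Rightarrow> ('k, 'b, 'n) module_scheme \<Rightarrow> ('a \<Rightarrow> 'b) set"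
where
  "leibniz_iso K P Q = {h \<in> leibniz_hom K P Q. bij_betw h (carrier P) (carrier Q)}"

definition lin_span ::
  "('k, 'r) ring_scheme \<Rightarrow> ('k, 'a, 'm) module_scheme \<Rightarrow> 'a set \<Rightarrow> 'a set"
where
  "lin_span K Q S = \<Inter>{N. submodule N K Q \<and> S \<subseteq> N}"

definition two_sided_ideal ::
  "('k, 'r) ring_scheme \<Rightarrow> ('k, 'a, 'm) module_scheme \<Rightarrow> 'a set \<Rightarrow> bool"
where
  "two_sided_ideal K Q I \<longleftrightarrow> submodule I K Q \<and>
     (\<forall>i\<in>I. \<forall>x\<in>carrier Q. i \<otimes>\<^bsub>Q\<^esub> x \<in> I \<and> x \<otimes>\<^bsub>Q\<^esub> i \<in> I)"

definition alg_quot :: "('k, 'a, 'm) module_scheme \<Rightarrow> 'a set \<Rightarrow> ('k, 'a set) module"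
where
  "alg_quot Q I =
     \<lparr>carrier = a_rcosets\<^bsub>Q\<^esub> I, mult = rcoset_mult Q I, one = I +>\<^bsub>Q\<^esub> \<one>\<^bsub>Q\<^esub>,
      zero = I, add = set_add Q, smult = (\<lambda>a A. \<Union>x\<in>A. I +>\<^bsub>Q\<^esub> (a \<odot>\<^bsub>Q\<^esub> x))\<rparr>"

text \<open>The map \<open>P/I \<rightarrow> Q/J\<close>, \<open>x + I \<mapsto> h x + J\<close>, for a homomorphism \<open>h\<close> with \<open>h ` I \<subseteq> J\<close>.\<close>

definition quot_map :: "('k, 'b, 'n) module_scheme \<Rightarrow> 'b set \<Rightarrow> ('a \<Rightarrow> 'b) \<Rightarrow> 'a set \<Rightarrow> 'b set"
where
  "quot_map Q J h A = (\<Union>x\<in>A. J +>\<^bsub>Q\<^esub> h x)"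

definition leib_ann :: "('k, 'r) ring_scheme \<Rightarrow> ('k, 'a, 'm) module_scheme \<Rightarrow> 'a set"
where
  "leib_ann K Q = lin_span K Q {x \<otimes>\<^bsub>Q\<^esub> x | x. x \<in> carrier Q}"

definition lie_quot :: "('k, 'r) ring_scheme \<Rightarrow> ('k, 'a, 'm) module_scheme \<Rightarrow> ('k, 'a set) module"
where
  "lie_quot K Q = alg_quot Q (leib_ann K Q)"

definition lie_quot_map ::
  "('k, 'r) ring_scheme \<Rightarrow> ('k, 'b, 'n) module_scheme \<Rightarrow> ('a \<Rightarrow> 'b) \<Rightarrow> 'a set \<Rightarrow> 'b set"
where
  "lie_quot_map K Q h = quot_map Q (leib_ann K Q) h"

definition lie_commutator ::
  "('k, 'r) ring_scheme \<Rightarrow> ('k, 'a, 'm) module_scheme \<Rightarrow> 'a set \<Rightarrow> 'a set \<Rightarrow> 'a set"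
where
  "lie_commutator K Q M N =
     lin_span K Q {(m \<otimes>\<^bsub>Q\<^esub> n) \<oplus>\<^bsub>Q\<^esub> (n \<otimes>\<^bsub>Q\<^esub> m) | m n. m \<in> M \<and> n \<in> N}"

definition lie_nilpotent :: "('k, 'r) ring_scheme \<Rightarrow> ('k, 'a, 'm) module_scheme \<Rightarrow> bool"
where
  "lie_nilpotent K Q \<longleftrightarrow> (\<exists>(k::nat) M.
     M 0 = {\<zero>\<^bsub>Q\<^esub>} \<and> M k = carrier Q \<and>
     (\<forall>i\<le>k. two_sided_ideal K Q (M i)) \<and>
     (\<forall>i<k. M i \<subseteq> M (Suc i) \<and> lie_commutator K Q (M (Suc i)) (carrier Q) \<subseteq> M i))"

text \<open>
  The free Leibniz algebra on \<open>X\<close> is the free nonassociative algebra on \<open>X\<close> (finitely supported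
  \<open>K\<close>-valued functions on the free magma) modulo the two-sided ideal generated by the Leibniz
  identity. Since an element of the free magma factors in at most one way, the product of the free
  nonassociative algebra needs no summation.
\<close>

datatype (magma_vars: 'x) magma_term =
  Var 'x | Bracket "'x magma_term" "'x magma_term"

definition free_nonassoc :: "('k, 'r) ring_scheme \<Rightarrow> 'x set \<Rightarrow> ('k, 'x magma_term \<Rightarrow> 'k) module"
where
  "free_nonassoc K X =
     \<lparr>carrier = {f. range f \<subseteq> carrier K \<and> finite {t. f t \<noteq> \<zero>\<^bsub>K\<^esub>} \<and>
                   (\<forall>t. f t \<noteq> \<zero>\<^bsub>K\<^esub> \<longrightarrow> magma_vars t \<subseteq> X)},
      mult = (\<lambda>f g t. case t of Var x \<Rightarrow> \<zero>\<^bsub>K\<^esub> | Bracket u v \<Rightarrow> f u \<otimes>\<^bsub>K\<^esub> g v),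
      one = (\<lambda>t. \<zero>\<^bsub>K\<^esub>), zero = (\<lambda>t. \<zero>\<^bsub>K\<^esub>), add = (\<lambda>f g t. f t \<oplus>\<^bsub>K\<^esub> g t),
      smult = (\<lambda>a f t. a \<otimes>\<^bsub>K\<^esub> f t)\<rparr>"

definition leibniz_relations :: "('k, 'r) ring_scheme \<Rightarrow> 'x set \<Rightarrow> ('x magma_term \<Rightarrow> 'k) set"
where
  "leibniz_relations K X = (let A = free_nonassoc K X in
     \<Inter>{I. two_sided_ideal K A I \<and>
        (\<forall>x\<in>carrier A. \<forall>y\<in>carrier A. \<forall>z\<in>carrier A.
           (x \<otimes>\<^bsub>A\<^esub> (y \<otimes>\<^bsub>A\<^esub> z)) \<ominus>\<^bsub>A\<^esub> (((x \<otimes>\<^bsub>A\<^esub> y) \<otimes>\<^bsub>A\<^esub> z) \<ominus>\<^bsub>A\<^esub> ((x \<otimes>\<^bsub>A\<^esub> z) \<otimes>\<^bsub>A\<^esub> y)) \<in> I)})"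

definition free_leibniz ::
  "('k, 'r) ring_scheme \<Rightarrow> 'x set \<Rightarrow> ('k, ('x magma_term \<Rightarrow> 'k) set) module"
where
  "free_leibniz K X = alg_quot (free_nonassoc K X) (leibniz_relations K X)"

definition free_leibniz_gen ::
  "('k, 'r) ring_scheme \<Rightarrow> 'x set \<Rightarrow> 'x \<Rightarrow> ('x magma_term \<Rightarrow> 'k) set"
where
  "free_leibniz_gen K X x =
     leibniz_relations K X +>\<^bsub>free_nonassoc K X\<^esub> (\<lambda>t. if t = Var x then \<one>\<^bsub>K\<^esub> else \<zero>\<^bsub>K\<^esub>)"

definition is_free_leibniz :: "('k, 'r) ring_scheme \<Rightarrow> ('k, 'f, 'm) module_scheme \<Rightarrow> bool"
where
  "is_free_leibniz K F \<longleftrightarrow> leibniz_algebra K F \<and>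
     (\<exists>X \<subseteq> carrier F. \<exists>h \<in> leibniz_iso K (free_leibniz K X) F.
        \<forall>x\<in>X. h (free_leibniz_gen K X x) = x)"

text \<open>A free presentation \<open>0 \<rightarrow> R \<rightarrow> F \<rightarrow> Q \<rightarrow> 0\<close> is given by the epimorphism \<open>p: F \<rightarrow> Q\<close>, with \<open>R\<close> its kernel.\<close>

definition free_presentation ::
  "('k, 'r) ring_scheme \<Rightarrow> ('k, 'f, 'm) module_scheme \<Rightarrow> ('f \<Rightarrow> 'a) \<Rightarrow> ('k, 'a, 'n) module_scheme \<Rightarrow> bool"
where
  "free_presentation K F p Q \<longleftrightarrow> is_free_leibniz K F \<and> p \<in> leibniz_epi K F Q"

text \<open>
  \<open>(R \<inter> [F,F]\<^sub>L\<^sub>i\<^sub>e) / [R,F]\<^sub>L\<^sub>i\<^sub>e\<close>, which is \<open>HL\<^sub>2\<close> of \<open>F/R\<close> when \<open>F\<close> is free, and the map induced on it by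
  a homomorphism \<open>f\<close> into \<open>F\<close> from the free algebra of another presentation.
\<close>

definition HL2_Lie ::
  "('k, 'r) ring_scheme \<Rightarrow> ('k, 'f, 'm) module_scheme \<Rightarrow> 'f set \<Rightarrow> ('k, 'f set) module"
where
  "HL2_Lie K F R =
     alg_quot (F\<lparr>carrier := R \<inter> lie_commutator K F (carrier F) (carrier F)\<rparr>)
       (lie_commutator K F R (carrier F))"

definition HL2_Lie_map ::
  "('k, 'r) ring_scheme \<Rightarrow> ('k, 'f, 'm) module_scheme \<Rightarrow> 'f set \<Rightarrow> ('e \<Rightarrow> 'f) \<Rightarrow> 'e set \<Rightarrow> 'f set"
where
  "HL2_Lie_map K F R f = quot_map F (lie_commutator K F R (carrier F)) f"

end

theory Submission
  imports Defs
begin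

text \<open>
  Write \<open>[x,y]\<^sub>L = [x,y] + [y,x]\<close>, and let \<open>\<phi>: G \<rightarrow> Q\<close> be the homomorphism and \<open>N\<close> its kernel.  Since \<open>2\<close> is
  invertible, \<open>[x,x]\<close> is half of \<open>[x,x]\<^sub>L\<close>, so \<open>G\<^sup>a\<^sup>n\<^sup>n \<subseteq> [G,G]\<^sub>L\<close>, and likewise for \<open>Q\<close>.
  
  \<^emph>\<open>Surjectivity.\<close>  That \<open>\<phi>\<close> is onto modulo the annihilators means \<open>Q = \<phi>(G) + Q\<^sup>a\<^sup>n\<^sup>n\<close>.  Let \<open>M\<^sub>i\<close> be a
  chain witnessing that \<open>Q\<close> is Lie-nilpotent.  If \<open>Q = \<phi>(G) + M\<^sub>i\<^sub>+\<^sub>1\<close>, then expanding a commutator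
  \<open>[\<phi> x + m, \<phi> y + n]\<^sub>L\<close> gives \<open>\<phi> [x,y]\<^sub>L\<close> plus elements of \<open>[M\<^sub>i\<^sub>+\<^sub>1,Q]\<^sub>L \<subseteq> M\<^sub>i\<close>.  Hence
  \<open>Q\<^sup>a\<^sup>n\<^sup>n \<subseteq> \<phi>(G) + M\<^sub>i\<close>, so \<open>Q = \<phi>(G) + M\<^sub>i\<close>; descending to \<open>M\<^sub>0 = 0\<close> yields \<open>Q = \<phi>(G)\<close>
  (lemma \<open>surj_of_lie_quot_surj\<close>).
  
  \<^emph>\<open>Injectivity.\<close>  Injectivity on the Lie quotients gives \<open>N \<subseteq> G\<^sup>a\<^sup>n\<^sup>n \<subseteq> [G,G]\<^sub>L\<close>.  The heart of the proof
  is that then \<open>N \<subseteq> [N,G]\<^sub>L\<close> (lemma \<open>kernel_subset_commutator_of_HL2_epi\<close>), the part of the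
  five-term exact sequence of \<open>0 \<rightarrow> N \<rightarrow> G \<rightarrow> Q \<rightarrow> 0\<close> that matters here.  Let \<open>p: F \<rightarrow> G\<close> and \<open>p': F' \<rightarrow> Q\<close>
  be the presentations, \<open>R'\<close> the kernel of \<open>p'\<close> and \<open>\<psi>: F \<rightarrow> F'\<close> a lift of \<open>\<phi>\<close>.  Write \<open>x \<in> N\<close> as \<open>p f\<close> with
  \<open>f \<in> [F,F]\<^sub>L\<close>.  Then \<open>\<psi> f\<close> represents a class in the second homology of \<open>Q\<close>, and since this class
  comes from \<open>G\<close>, subtracting from \<open>f\<close> an element of the kernel of \<open>p\<close> achieves \<open>\<psi> f \<in> [R',F']\<^sub>L\<close>.
  As \<open>F'\<close> is free and \<open>\<phi>\<close> is onto, \<open>p' = \<phi> \<circ> \<sigma>\<close> for some \<open>\<sigma>: F' \<rightarrow> G\<close>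
  (lemma \<open>free_leibniz_projective\<close>), and \<open>\<sigma>\<close> maps \<open>R'\<close> into \<open>N\<close>, so \<open>\<sigma> (\<psi> f) \<in> [N,G]\<^sub>L\<close>.  Finally \<open>p\<close> and
  \<open>\<sigma> \<circ> \<psi>\<close> agree modulo \<open>N\<close>, hence agree modulo \<open>[N,G]\<^sub>L\<close> on \<open>[F,F]\<^sub>L\<close>, and \<open>x = p f \<in> [N,G]\<^sub>L\<close>.  Now a
  chain for \<open>G\<close> pushes \<open>N = [N,G]\<^sub>L\<close> down to \<open>0\<close>.
\<close>

text \<open>
  The common ground of Leibniz algebras and of the free nonassociative algebras that present them.
\<close>

locale nonassoc_algebra = module K Q
  for K :: "('k, 'r) ring_scheme" and Q :: "('k, 'a, 'm) module_scheme" (structure) +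
  assumes bracket_closed [simp, intro]:
      "\<lbrakk>x \<in> carrier Q; y \<in> carrier Q\<rbrakk> \<Longrightarrow> x \<otimes> y \<in> carrier Q"
    and bracket_l_distr:
      "\<lbrakk>x \<in> carrier Q; y \<in> carrier Q; z \<in> carrier Q\<rbrakk> \<Longrightarrow> (x \<oplus> y) \<otimes> z = (x \<otimes> z) \<oplus> (y \<otimes> z)"
    and bracket_r_distr:
      "\<lbrakk>x \<in> carrier Q; y \<in> carrier Q; z \<in> carrier Q\<rbrakk> \<Longrightarrow> x \<otimes> (y \<oplus> z) = (x \<otimes> y) \<oplus> (x \<otimes> z)"
    and bracket_smult_l:
      "\<lbrakk>a \<in> carrier K; x \<in> carrier Q; y \<in> carrier Q\<rbrakk> \<Longrightarrow> (a \<odot> x) \<otimes> y = a \<odot> (x \<otimes> y)"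
    and bracket_smult_r:
      "\<lbrakk>a \<in> carrier K; x \<in> carrier Q; y \<in> carrier Q\<rbrakk> \<Longrightarrow> x \<otimes> (a \<odot> y) = a \<odot> (x \<otimes> y)"

lemma leibniz_algebra_nonassoc:
  assumes "leibniz_algebra K Q" shows "nonassoc_algebra K Q"
proof -
  interpret leibniz_algebra K Q by fact
  show ?thesis
    by unfold_locales
      (simp_all add: bracket_closed bracket_l_distr bracket_r_distr bracket_smult_l bracket_smult_r)
qed

section \<open>Submodules, spans and Lie commutators\<close>

lemma lin_span_least: "\<lbrakk>submodule N K Q; S \<subseteq> N\<rbrakk> \<Longrightarrow> lin_span K Q S \<subseteq> N"
  unfolding lin_span_def by blast

lemma lin_span_incl: "S \<subseteq> lin_span K Q S"
  unfolding lin_span_def by blast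

lemma lie_commutator_least:
  assumes "submodule U K Q"
    and "\<And>m n. \<lbrakk>m \<in> M; n \<in> N\<rbrakk> \<Longrightarrow> (m \<otimes>\<^bsub>Q\<^esub> n) \<oplus>\<^bsub>Q\<^esub> (n \<otimes>\<^bsub>Q\<^esub> m) \<in> U"
  shows "lie_commutator K Q M N \<subseteq> U"
  unfolding lie_commutator_def by (rule lin_span_least) (use assms in auto)

lemma lie_commutator_gen:
  "\<lbrakk>m \<in> M; n \<in> N\<rbrakk> \<Longrightarrow> (m \<otimes>\<^bsub>Q\<^esub> n) \<oplus>\<^bsub>Q\<^esub> (n \<otimes>\<^bsub>Q\<^esub> m) \<in> lie_commutator K Q M N"
  unfolding lie_commutator_def by (rule subsetD[OF lin_span_incl]) blast

lemma lie_commutator_mono: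
  assumes "M \<subseteq> M'" and "N \<subseteq> N'"
  shows "lie_commutator K Q M N \<subseteq> lie_commutator K Q M' N'"
proof -
  let ?gens = "\<lambda>M N. {(m \<otimes>\<^bsub>Q\<^esub> n) \<oplus>\<^bsub>Q\<^esub> (n \<otimes>\<^bsub>Q\<^esub> m) | m n. m \<in> M \<and> n \<in> N}"
  have gens: "?gens M N \<subseteq> ?gens M' N'"
    by (intro Collect_mono impI) (use assms in blast)
  have "{U. submodule U K Q \<and> ?gens M' N' \<subseteq> U} \<subseteq> {U. submodule U K Q \<and> ?gens M N \<subseteq> U}"
    by (intro Collect_mono impI conjI) (use subset_trans[OF gens] in simp_all)
  then show ?thesis
    unfolding lie_commutator_def lin_span_def by (rule Inter_anti_mono)
qed

context nonassoc_algebra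
begin

lemma bracket_zero [simp]:
  assumes x: "x \<in> carrier Q" shows "x \<otimes> \<zero> = \<zero>" and "\<zero> \<otimes> x = \<zero>"
proof -
  have "x \<otimes> (\<zero>\<^bsub>K\<^esub> \<odot> x) = \<zero>\<^bsub>K\<^esub> \<odot> (x \<otimes> x)"
    by (rule bracket_smult_r[OF R.zero_closed x x])
  then show "x \<otimes> \<zero> = \<zero>"
    unfolding smult_l_null[OF x] smult_l_null[OF bracket_closed[OF x x]] .
  have "(\<zero>\<^bsub>K\<^esub> \<odot> x) \<otimes> x = \<zero>\<^bsub>K\<^esub> \<odot> (x \<otimes> x)"
    by (rule bracket_smult_l[OF R.zero_closed x x])
  then show "\<zero> \<otimes> x = \<zero>"
    unfolding smult_l_null[OF x] smult_l_null[OF bracket_closed[OF x x]] .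
qed

lemma minus_eq_zero_iff:
  assumes "x \<in> carrier Q" "y \<in> carrier Q" shows "x \<ominus> y = \<zero> \<longleftrightarrow> x = y"
proof
  assume "x \<ominus> y = \<zero>"
  moreover have "(x \<ominus> y) \<oplus> y = x"
    using assms by (simp add: a_minus_def a_assoc l_neg)
  ultimately show "x = y" using assms by simp
next
  assume "x = y"
  then show "x \<ominus> y = \<zero>" using assms by (simp add: a_minus_def r_neg)
qed

lemma submodule_of_closed:
  assumes "H \<subseteq> carrier Q" and "\<zero> \<in> H"
    and "\<And>x y. \<lbrakk>x \<in> H; y \<in> H\<rbrakk> \<Longrightarrow> x \<oplus> y \<in> H"
    and "\<And>a x. \<lbrakk>a \<in> carrier K; x \<in> H\<rbrakk> \<Longrightarrow> a \<odot> x \<in> H"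
  shows "submodule H K Q"
proof (rule submoduleI)
  fix x assume "x \<in> H"
  then have "\<ominus> x = (\<ominus>\<^bsub>K\<^esub> \<one>\<^bsub>K\<^esub>) \<odot> x"
    using assms(1) by (subst smult_l_minus) auto
  then show "\<ominus> x \<in> H" using assms(4) \<open>x \<in> H\<close> by auto
qed (use assms in auto)

lemma submodule_subset: "submodule H K Q \<Longrightarrow> H \<subseteq> carrier Q"
  using submoduleE(1) by blast

lemma submodule_zero: "submodule H K Q \<Longrightarrow> \<zero> \<in> H"
  using subgroup.one_closed[OF submodule.axioms(1), of H K Q] by simp

lemma submodule_add: "\<lbrakk>submodule H K Q; x \<in> H; y \<in> H\<rbrakk> \<Longrightarrow> x \<oplus> y \<in> H"
  using submoduleE(5) by blast

lemma submodule_smult: "\<lbrakk>submodule H K Q; a \<in> carrier K; x \<in> H\<rbrakk> \<Longrightarrow> a \<odot> x \<in> H"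
  using submoduleE(4) by blast

lemma submodule_minus: "\<lbrakk>submodule H K Q; x \<in> H; y \<in> H\<rbrakk> \<Longrightarrow> x \<ominus> y \<in> H"
  unfolding a_minus_def using submoduleE(3,5) by blast

lemma submodule_abelian_subgroup: "submodule H K Q \<Longrightarrow> abelian_subgroup H Q"
  using abelian_subgroupI3[OF additive_subgroupI[OF submodule.axioms(1)] M.abelian_group_axioms] .

lemma submodule_Inter:
  assumes "\<N> \<noteq> {}" and "\<And>N. N \<in> \<N> \<Longrightarrow> submodule N K Q"
  shows "submodule (\<Inter>\<N>) K Q"
  by (rule submodule_of_closed)
    (use assms in \<open>auto dest: submodule_subset intro: submodule_zero submodule_add submodule_smult\<close>)

lemma submodule_add_set:
  assumes "submodule M K Q" and "submodule N K Q"
  shows "submodule (set_add Q M N) K Q"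
proof (rule submodule_of_closed)
  have car: "x \<in> carrier Q" if "x \<in> M \<or> x \<in> N" for x
    using that assms submodule_subset by blast
  show "set_add Q M N \<subseteq> carrier Q"
    using car by (auto simp: set_add_def')
  show "\<zero> \<in> set_add Q M N"
    using submodule_zero[OF assms(1)] submodule_zero[OF assms(2)]
    unfolding set_add_def' by force
  show "x \<oplus> y \<in> set_add Q M N" if xy: "x \<in> set_add Q M N" "y \<in> set_add Q M N" for x y
  proof -
    obtain m n m' n' where mn: "m \<in> M" "n \<in> N" "m' \<in> M" "n' \<in> N" "x = m \<oplus> n" "y = m' \<oplus> n'"
      using xy unfolding set_add_def' by blast
    then have "x \<oplus> y = (m \<oplus> m') \<oplus> (n \<oplus> n')"
      using car by (simp add: a_ac)
    then show ?thesis
      using mn submodule_add assms unfolding set_add_def' by blast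
  qed
  show "a \<odot> x \<in> set_add Q M N" if ax: "a \<in> carrier K" "x \<in> set_add Q M N" for a x
  proof -
    obtain m n where mn: "m \<in> M" "n \<in> N" "x = m \<oplus> n"
      using ax unfolding set_add_def' by blast
    then have "a \<odot> x = a \<odot> m \<oplus> a \<odot> n"
      using car that by (simp add: smult_r_distr)
    then show ?thesis
      using mn that submodule_smult assms unfolding set_add_def' by blast
  qed
qed

lemma lin_span_submodule: "S \<subseteq> carrier Q \<Longrightarrow> submodule (lin_span K Q S) K Q"
  unfolding lin_span_def by (rule submodule_Inter) (use carrier_is_submodule in auto)

lemma lie_commutator_submodule:
  "\<lbrakk>M \<subseteq> carrier Q; N \<subseteq> carrier Q\<rbrakk> \<Longrightarrow> submodule (lie_commutator K Q M N) K Q"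
  unfolding lie_commutator_def by (rule lin_span_submodule) auto

lemma leib_ann_submodule: "submodule (leib_ann K Q) K Q"
  unfolding leib_ann_def by (rule lin_span_submodule) auto

lemma lie_commutator_ideal_subset:
  assumes "two_sided_ideal K Q I"
  shows "lie_commutator K Q I (carrier Q) \<subseteq> I"
  using assms submodule_add unfolding two_sided_ideal_def
  by (intro lie_commutator_least) auto

text \<open>
  Halving: \<open>[x,x]\<close> is \<open>1/2\<close> times the symmetrised bracket of \<open>x\<close> with itself.
\<close>

lemma leib_ann_subset_commutator:
  assumes "\<one>\<^bsub>K\<^esub> \<oplus>\<^bsub>K\<^esub> \<one>\<^bsub>K\<^esub> \<in> Units K"
  shows "leib_ann K Q \<subseteq> lie_commutator K Q (carrier Q) (carrier Q)"
  unfolding leib_ann_def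
proof (rule lin_span_least)
  let ?C = "lie_commutator K Q (carrier Q) (carrier Q)"
  show C: "submodule ?C K Q" by (rule lie_commutator_submodule) auto
  obtain c where c: "c \<in> carrier K" "c \<otimes>\<^bsub>K\<^esub> (\<one>\<^bsub>K\<^esub> \<oplus>\<^bsub>K\<^esub> \<one>\<^bsub>K\<^esub>) = \<one>\<^bsub>K\<^esub>"
    using assms unfolding Units_def by blast
  have "x \<otimes> x \<in> ?C" if "x \<in> carrier Q" for x
  proof -
    have "x \<otimes> x \<oplus> x \<otimes> x = (\<one>\<^bsub>K\<^esub> \<oplus>\<^bsub>K\<^esub> \<one>\<^bsub>K\<^esub>) \<odot> (x \<otimes> x)"
      using that by (simp add: smult_l_distr)
    then have "x \<otimes> x = c \<odot> (x \<otimes> x \<oplus> x \<otimes> x)"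
      using that c by (simp flip: smult_assoc1)
    then show ?thesis
      using submodule_smult[OF C c(1) lie_commutator_gen[OF that that]] by simp
  qed
  then show "{x \<otimes> x |x. x \<in> carrier Q} \<subseteq> ?C" by auto
qed

end

section \<open>Homomorphisms\<close>

locale nonassoc_hom = P: nonassoc_algebra K P + Q: nonassoc_algebra K Q
  for K :: "('k, 'r) ring_scheme" and P :: "('k, 'a, 'm) module_scheme"
    and Q :: "('k, 'b, 'n) module_scheme" +
  fixes h :: "'a \<Rightarrow> 'b"
  assumes hom: "h \<in> leibniz_hom K P Q"
begin

lemma hom_closed [simp, intro]: "x \<in> carrier P \<Longrightarrow> h x \<in> carrier Q"
  and hom_add [simp]:
    "\<lbrakk>x \<in> carrier P; y \<in> carrier P\<rbrakk> \<Longrightarrow> h (x \<oplus>\<^bsub>P\<^esub> y) = h x \<oplus>\<^bsub>Q\<^esub> h y"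
  and hom_smult [simp]:
    "\<lbrakk>a \<in> carrier K; x \<in> carrier P\<rbrakk> \<Longrightarrow> h (a \<odot>\<^bsub>P\<^esub> x) = a \<odot>\<^bsub>Q\<^esub> h x"
  and hom_bracket [simp]:
    "\<lbrakk>x \<in> carrier P; y \<in> carrier P\<rbrakk> \<Longrightarrow> h (x \<otimes>\<^bsub>P\<^esub> y) = h x \<otimes>\<^bsub>Q\<^esub> h y"
  using hom unfolding leibniz_hom_def by auto

lemma hom_zero [simp]: "h \<zero>\<^bsub>P\<^esub> = \<zero>\<^bsub>Q\<^esub>"
  using hom_smult[of "\<zero>\<^bsub>K\<^esub>" "\<zero>\<^bsub>P\<^esub>"] by simp

lemma hom_minus [simp]:
  assumes "x \<in> carrier P" "y \<in> carrier P" shows "h (x \<ominus>\<^bsub>P\<^esub> y) = h x \<ominus>\<^bsub>Q\<^esub> h y"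
proof -
  have "h (x \<ominus>\<^bsub>P\<^esub> y) \<oplus>\<^bsub>Q\<^esub> h y = h x"
    using assms by (simp flip: hom_add add: a_minus_def P.a_assoc P.l_neg)
  then show ?thesis
    using assms by (metis P.minus_closed a_minus_def Q.add.inv_solve_right hom_closed)
qed

lemma vimage_submodule:
  assumes "submodule N K Q" shows "submodule {x \<in> carrier P. h x \<in> N} K P"
  by (rule P.submodule_of_closed)
    (use assms Q.submodule_zero Q.submodule_add Q.submodule_smult in auto)

lemma image_submodule:
  assumes "submodule N K P" shows "submodule (h ` N) K Q"
proof (rule Q.submodule_of_closed)
  have car: "x \<in> carrier P" if "x \<in> N" for x
    using that assms P.submodule_subset by blast
  show "h ` N \<subseteq> carrier Q" using car by auto
  show "\<zero>\<^bsub>Q\<^esub> \<in> h ` N" using P.submodule_zero[OF assms] hom_zero by force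
  show "x \<oplus>\<^bsub>Q\<^esub> y \<in> h ` N" if "x \<in> h ` N" "y \<in> h ` N" for x y
    using that car P.submodule_add[OF assms] by (auto simp flip: hom_add)
  show "a \<odot>\<^bsub>Q\<^esub> x \<in> h ` N" if "a \<in> carrier K" "x \<in> h ` N" for a x
    using that car P.submodule_smult[OF assms] by (auto simp flip: hom_smult)
qed

lemma kernel_ideal: "two_sided_ideal K P (a_kernel P Q h)"
proof -
  have "a_kernel P Q h = {x \<in> carrier P. h x \<in> {\<zero>\<^bsub>Q\<^esub>}}"
    unfolding a_kernel_def' by simp
  moreover have "submodule {\<zero>\<^bsub>Q\<^esub>} K Q"
    by (rule Q.submodule_of_closed) auto
  ultimately have "submodule (a_kernel P Q h) K P"
    using vimage_submodule[of "{\<zero>\<^bsub>Q\<^esub>}"] by simp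
  then show ?thesis
    unfolding two_sided_ideal_def by (auto simp: a_kernel_def')
qed

lemma hom_lie_commutator:
  assumes "M \<subseteq> carrier P" "N \<subseteq> carrier P" "h ` M \<subseteq> M'" "h ` N \<subseteq> N'"
    and "M' \<subseteq> carrier Q" "N' \<subseteq> carrier Q" and "x \<in> lie_commutator K P M N"
  shows "h x \<in> lie_commutator K Q M' N'"
proof -
  have "lie_commutator K P M N \<subseteq> {x \<in> carrier P. h x \<in> lie_commutator K Q M' N'}"
  proof (rule lie_commutator_least)
    show "submodule {x \<in> carrier P. h x \<in> lie_commutator K Q M' N'} K P"
      using assms by (intro vimage_submodule Q.lie_commutator_submodule)
    fix m n assume mn: "m \<in> M" "n \<in> N"
    then have "m \<in> carrier P" "n \<in> carrier P" using assms by auto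
    moreover have "h m \<otimes>\<^bsub>Q\<^esub> h n \<oplus>\<^bsub>Q\<^esub> h n \<otimes>\<^bsub>Q\<^esub> h m \<in> lie_commutator K Q M' N'"
      using mn assms by (intro lie_commutator_gen) auto
    ultimately show "m \<otimes>\<^bsub>P\<^esub> n \<oplus>\<^bsub>P\<^esub> n \<otimes>\<^bsub>P\<^esub> m \<in> {x \<in> carrier P. h x \<in> lie_commutator K Q M' N'}"
      by simp
  qed
  then show ?thesis using assms by auto
qed

text \<open>
  The image of a submodule is a submodule, and by surjectivity this one contains all the generators
  of the commutator of \<open>Q\<close>.
\<close>

lemma lie_commutator_image:
  assumes "h ` carrier P = carrier Q"
  shows "lie_commutator K Q (carrier Q) (carrier Q)
           \<subseteq> h ` lie_commutator K P (carrier P) (carrier P)"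
proof (rule lie_commutator_least)
  show "submodule (h ` lie_commutator K P (carrier P) (carrier P)) K Q"
    by (intro image_submodule P.lie_commutator_submodule) auto
  fix m n assume "m \<in> carrier Q" "n \<in> carrier Q"
  then obtain a b where "a \<in> carrier P" "b \<in> carrier P" "m = h a" "n = h b"
    using assms by blast
  then show "m \<otimes>\<^bsub>Q\<^esub> n \<oplus>\<^bsub>Q\<^esub> n \<otimes>\<^bsub>Q\<^esub> m \<in> h ` lie_commutator K P (carrier P) (carrier P)"
    using lie_commutator_gen[of a "carrier P" b "carrier P" P K]
    by (auto intro!: image_eqI[where x = "a \<otimes>\<^bsub>P\<^esub> b \<oplus>\<^bsub>P\<^esub> b \<otimes>\<^bsub>P\<^esub> a"])
qed

lemma hom_leib_ann:
  assumes "x \<in> leib_ann K P" shows "h x \<in> leib_ann K Q"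
proof -
  have "leib_ann K P \<subseteq> {x \<in> carrier P. h x \<in> leib_ann K Q}"
    unfolding leib_ann_def[of K P]
  proof (rule lin_span_least)
    show "submodule {x \<in> carrier P. h x \<in> leib_ann K Q} K P"
      by (intro vimage_submodule Q.leib_ann_submodule)
    have "h x \<otimes>\<^bsub>Q\<^esub> h x \<in> leib_ann K Q" if "x \<in> carrier P" for x
      unfolding leib_ann_def using that lin_span_incl by fast
    then show "{x \<otimes>\<^bsub>P\<^esub> x |x. x \<in> carrier P} \<subseteq> {x \<in> carrier P. h x \<in> leib_ann K Q}"
      by auto
  qed
  then show ?thesis using assms by auto
qed

end

lemma nonassoc_homI:
  assumes "leibniz_algebra K P" "leibniz_algebra K Q" "h \<in> leibniz_hom K P Q"
  shows "nonassoc_hom K P Q h"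
  by (intro nonassoc_hom.intro nonassoc_hom_axioms.intro leibniz_algebra_nonassoc assms)

lemma leibniz_hom_comp:
  assumes "h \<in> leibniz_hom K P Q" and "k \<in> leibniz_hom K Q R"
  shows "(\<lambda>x. k (h x)) \<in> leibniz_hom K P R"
  using assms unfolding leibniz_hom_def by (auto simp: Pi_iff)

text \<open>
  The homomorphism theorem, with the kernel condition stated on pairs of elements, so that no
  algebraic structure has to be known on \<open>Q\<close>.
\<close>

lemma leibniz_hom_factor:
  assumes "\<pi> \<in> leibniz_epi K P Q" and "E \<in> leibniz_hom K P R"
    and P: "nonassoc_algebra K P"
    and ker: "\<And>a b. \<lbrakk>a \<in> carrier P; b \<in> carrier P; \<pi> a = \<pi> b\<rbrakk> \<Longrightarrow> E a = E b"
  obtains \<sigma> where "\<sigma> \<in> leibniz_hom K Q R" and "\<And>a. a \<in> carrier P \<Longrightarrow> \<sigma> (\<pi> a) = E a"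
proof
  interpret P: nonassoc_algebra K P by fact
  have \<pi>: "\<pi> \<in> leibniz_hom K P Q" and onto: "\<pi> ` carrier P = carrier Q"
    using assms unfolding leibniz_epi_def by auto
  define \<sigma> where "\<sigma> y = E (inv_into (carrier P) \<pi> y)" for y
  show \<sigma>: "\<sigma> (\<pi> a) = E a" if "a \<in> carrier P" for a
    unfolding \<sigma>_def using that by (intro ker) (auto intro: inv_into_into f_inv_into_f)
  have obt: "\<exists>a\<in>carrier P. y = \<pi> a" if "y \<in> carrier Q" for y
    using that onto by blast
  show "\<sigma> \<in> leibniz_hom K Q R"
    unfolding leibniz_hom_def
  proof (intro CollectI conjI ballI funcsetI)
    fix y assume "y \<in> carrier Q"
    then obtain a where a: "a \<in> carrier P" "y = \<pi> a" using obt by blast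
    then show "\<sigma> y \<in> carrier R" using \<sigma> assms(2) unfolding leibniz_hom_def by auto
    fix z assume "z \<in> carrier Q"
    then obtain b where b: "b \<in> carrier P" "z = \<pi> b" using obt by blast
    have "\<sigma> (\<pi> (a \<oplus>\<^bsub>P\<^esub> b)) = \<sigma> (\<pi> a) \<oplus>\<^bsub>R\<^esub> \<sigma> (\<pi> b)"
      using a b \<sigma> assms(2) unfolding leibniz_hom_def by simp
    then show "\<sigma> (y \<oplus>\<^bsub>Q\<^esub> z) = \<sigma> y \<oplus>\<^bsub>R\<^esub> \<sigma> z"
      using a b \<pi> unfolding leibniz_hom_def by simp
    have "\<sigma> (\<pi> (a \<otimes>\<^bsub>P\<^esub> b)) = \<sigma> (\<pi> a) \<otimes>\<^bsub>R\<^esub> \<sigma> (\<pi> b)"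
      using a b \<sigma> assms(2) unfolding leibniz_hom_def by simp
    then show "\<sigma> (y \<otimes>\<^bsub>Q\<^esub> z) = \<sigma> y \<otimes>\<^bsub>R\<^esub> \<sigma> z"
      using a b \<pi> unfolding leibniz_hom_def by simp
  next
    fix c y assume c: "c \<in> carrier K" and "y \<in> carrier Q"
    then obtain a where a: "a \<in> carrier P" "y = \<pi> a" using obt by blast
    have "\<sigma> (\<pi> (c \<odot>\<^bsub>P\<^esub> a)) = c \<odot>\<^bsub>R\<^esub> \<sigma> (\<pi> a)"
      using a c \<sigma> assms(2) unfolding leibniz_hom_def by simp
    then show "\<sigma> (c \<odot>\<^bsub>Q\<^esub> y) = c \<odot>\<^bsub>R\<^esub> \<sigma> y"
      using a c \<pi> unfolding leibniz_hom_def by simp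
  qed
qed

section \<open>Quotients\<close>

text \<open>
  The operations of \<^const>\<open>alg_quot\<close> are unions over representatives; since \<open>I\<close> is an ideal, every
  representative contributes the same coset.
\<close>

lemma (in nonassoc_algebra) coset_map_epi:
  assumes "two_sided_ideal K Q I"
  shows "(\<lambda>x. I +> x) \<in> leibniz_epi K Q (alg_quot Q I)"
proof -
  have I: "submodule I K Q" and Il: "\<And>i x. \<lbrakk>i \<in> I; x \<in> carrier Q\<rbrakk> \<Longrightarrow> i \<otimes> x \<in> I"
    and Ir: "\<And>i x. \<lbrakk>i \<in> I; x \<in> carrier Q\<rbrakk> \<Longrightarrow> x \<otimes> i \<in> I"
    using assms unfolding two_sided_ideal_def by auto
  interpret I: abelian_subgroup I Q by (rule submodule_abelian_subgroup[OF I])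
  have subset: "I \<subseteq> carrier Q" by (rule submodule_subset[OF I])
  have car: "i \<in> carrier Q" if "i \<in> I" for i using that subset by blast
  have coset_eqI: "I +> (i \<oplus> x) = I +> x" if "i \<in> I" "x \<in> carrier Q" for i x
    using that I.a_repr_independence'[of "i \<oplus> x" x] a_rcosI[OF _ subset] by auto
  have mem: "\<exists>i\<in>I. y = i \<oplus> x" if "y \<in> I +> x" for x y
    using that unfolding a_r_coset_def' by auto
  have smult: "(\<Union>y\<in>I +> x. I +> (a \<odot> y)) = I +> (a \<odot> x)"
    if "a \<in> carrier K" "x \<in> carrier Q" for a x
  proof -
    have "I +> (a \<odot> y) = I +> (a \<odot> x)" if y: "y \<in> I +> x" for y
    proof -
      obtain i where i: "i \<in> I" "y = i \<oplus> x" using mem[OF y] by blast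
      then have "a \<odot> y = a \<odot> i \<oplus> a \<odot> x"
        using \<open>a \<in> carrier K\<close> \<open>x \<in> carrier Q\<close> car by (simp add: smult_r_distr)
      then show ?thesis
        using coset_eqI[OF submodule_smult[OF I]] i \<open>a \<in> carrier K\<close> \<open>x \<in> carrier Q\<close> by simp
    qed
    then show ?thesis
      by (intro UN_constant_eq[OF I.a_rcos_self[OF \<open>x \<in> carrier Q\<close>]] ballI)
  qed
  have mult: "rcoset_mult Q I (I +> x) (I +> y) = I +> (x \<otimes> y)"
    if xy: "x \<in> carrier Q" "y \<in> carrier Q" for x y
  proof -
    have "I +> (x' \<otimes> y') = I +> (x \<otimes> y)" if x': "x' \<in> I +> x" and y': "y' \<in> I +> y" for x' y'
    proof -
      obtain i j where ij: "i \<in> I" "x' = i \<oplus> x" "j \<in> I" "y' = j \<oplus> y"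
        using mem[OF x'] mem[OF y'] by blast
      have "x' \<otimes> y' = (i \<otimes> (j \<oplus> y) \<oplus> x \<otimes> j) \<oplus> x \<otimes> y"
        using ij xy car by (simp add: bracket_l_distr bracket_r_distr a_ac)
      moreover have "i \<otimes> (j \<oplus> y) \<oplus> x \<otimes> j \<in> I"
        using ij xy car by (intro submodule_add[OF I] Il Ir) auto
      ultimately show ?thesis using coset_eqI xy by simp
    qed
    then have "(\<Union>y'\<in>I +> y. I +> (x' \<otimes> y')) = I +> (x \<otimes> y)" if "x' \<in> I +> x" for x'
      using that by (intro UN_constant_eq[OF I.a_rcos_self[OF xy(2)]] ballI)
    then show ?thesis
      unfolding rcoset_mult_def
      by (intro UN_constant_eq[OF I.a_rcos_self[OF xy(1)]] ballI)
  qed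
  have "(\<lambda>x. I +> x) \<in> leibniz_hom K Q (alg_quot Q I)"
    unfolding leibniz_hom_def
    by (simp add: alg_quot_def smult mult I.a_rcos_sum a_rcosetsI[OF subset])
  moreover have "(\<lambda>x. I +> x) ` carrier Q = carrier (alg_quot Q I)"
    by (simp add: alg_quot_def A_RCOSETS_def a_r_coset_def RCOSETS_def image_def) blast
  ultimately show ?thesis unfolding leibniz_epi_def by blast
qed

lemma (in nonassoc_algebra) coset_eq_iff:
  assumes "submodule I K Q" "x \<in> carrier Q" "y \<in> carrier Q"
  shows "I +> x = I +> y \<longleftrightarrow> x \<ominus> y \<in> I"
proof -
  interpret I: abelian_subgroup I Q by (rule submodule_abelian_subgroup[OF assms(1)])
  show ?thesis
    using I.a_rcos_module[OF assms(3,2)] I.a_repr_independence'[of x y] I.a_rcos_self[of x] assms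
    unfolding a_minus_def by auto
qed

section \<open>Free nonassociative algebras\<close>

text \<open>
  The basis element \<open>t\<close> of the free nonassociative algebra.
\<close>

definition magma_delta :: "('k, 'r) ring_scheme \<Rightarrow> 'x magma_term \<Rightarrow> 'x magma_term \<Rightarrow> 'k"
  where "magma_delta K t = (\<lambda>s. if s = t then \<one>\<^bsub>K\<^esub> else \<zero>\<^bsub>K\<^esub>)"

fun magma_eval :: "('k, 'a, 'm) module_scheme \<Rightarrow> ('x \<Rightarrow> 'a) \<Rightarrow> 'x magma_term \<Rightarrow> 'a" where
  "magma_eval Q g (Var x) = g x"
| "magma_eval Q g (Bracket s t) = magma_eval Q g s \<otimes>\<^bsub>Q\<^esub> magma_eval Q g t"

lemma free_nonassoc_simps [simp]:
  "f \<oplus>\<^bsub>free_nonassoc K X\<^esub> g = (\<lambda>t. f t \<oplus>\<^bsub>K\<^esub> g t)"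
  "\<zero>\<^bsub>free_nonassoc K X\<^esub> = (\<lambda>t. \<zero>\<^bsub>K\<^esub>)"
  "a \<odot>\<^bsub>free_nonassoc K X\<^esub> f = (\<lambda>t. a \<otimes>\<^bsub>K\<^esub> f t)"
  "f \<otimes>\<^bsub>free_nonassoc K X\<^esub> g =
     (\<lambda>t. case t of Var x \<Rightarrow> \<zero>\<^bsub>K\<^esub> | Bracket u v \<Rightarrow> f u \<otimes>\<^bsub>K\<^esub> g v)"
  by (simp_all add: free_nonassoc_def)

lemma free_nonassoc_carrier:
  "f \<in> carrier (free_nonassoc K X) \<longleftrightarrow>
     (\<forall>t. f t \<in> carrier K) \<and> finite {t. f t \<noteq> \<zero>\<^bsub>K\<^esub>} \<and>
     (\<forall>t. f t \<noteq> \<zero>\<^bsub>K\<^esub> \<longrightarrow> magma_vars t \<subseteq> X)"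
  by (auto simp: free_nonassoc_def)

lemma free_nonassoc_algebra:
  fixes X :: "'x set"
  assumes "cring K" shows "nonassoc_algebra K (free_nonassoc K X)"
proof -
  interpret K: cring K by fact
  let ?A = "free_nonassoc K X"
  have val: "f t \<in> carrier K" if "f \<in> carrier ?A" for f t
    using that by (simp add: free_nonassoc_carrier)
  have add: "f \<oplus>\<^bsub>?A\<^esub> g \<in> carrier ?A" if "f \<in> carrier ?A" "g \<in> carrier ?A" for f g
  proof -
    have "{t. f t \<oplus>\<^bsub>K\<^esub> g t \<noteq> \<zero>\<^bsub>K\<^esub>} \<subseteq> {t. f t \<noteq> \<zero>\<^bsub>K\<^esub>} \<union> {t. g t \<noteq> \<zero>\<^bsub>K\<^esub>}"
      by auto
    with that show ?thesis
      by (auto simp: free_nonassoc_carrier intro: finite_subset) (metis K.add.l_cancel_one' K.zero_closed subsetD)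
  qed
  have smult: "a \<odot>\<^bsub>?A\<^esub> f \<in> carrier ?A" if "a \<in> carrier K" "f \<in> carrier ?A" for a f
  proof -
    have "{t. a \<otimes>\<^bsub>K\<^esub> f t \<noteq> \<zero>\<^bsub>K\<^esub>} \<subseteq> {t. f t \<noteq> \<zero>\<^bsub>K\<^esub>}"
      using that(1) by auto
    with that show ?thesis
      by (auto simp: free_nonassoc_carrier intro: finite_subset)
  qed
  have mult: "f \<otimes>\<^bsub>?A\<^esub> g \<in> carrier ?A" if f: "f \<in> carrier ?A" and g: "g \<in> carrier ?A" for f g
  proof -
    have nz: "\<exists>u v. t = Bracket u v \<and> f u \<noteq> \<zero>\<^bsub>K\<^esub> \<and> g v \<noteq> \<zero>\<^bsub>K\<^esub>"
      if "(f \<otimes>\<^bsub>?A\<^esub> g) t \<noteq> \<zero>\<^bsub>K\<^esub>" for t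
      using that val[OF f] val[OF g] by (cases t) auto
    then have "{t. (f \<otimes>\<^bsub>?A\<^esub> g) t \<noteq> \<zero>\<^bsub>K\<^esub>}
        \<subseteq> case_prod Bracket ` ({t. f t \<noteq> \<zero>\<^bsub>K\<^esub>} \<times> {t. g t \<noteq> \<zero>\<^bsub>K\<^esub>})"
      by fast
    moreover have "finite (case_prod Bracket ` ({t. f t \<noteq> \<zero>\<^bsub>K\<^esub>} \<times> {t. g t \<noteq> \<zero>\<^bsub>K\<^esub>}))"
      using f g by (simp add: free_nonassoc_carrier)
    ultimately have "finite {t. (f \<otimes>\<^bsub>?A\<^esub> g) t \<noteq> \<zero>\<^bsub>K\<^esub>}"
      by (rule finite_subset)
    moreover have "magma_vars t \<subseteq> X" if t: "(f \<otimes>\<^bsub>?A\<^esub> g) t \<noteq> \<zero>\<^bsub>K\<^esub>" for t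
    proof -
      obtain u v where uv: "t = Bracket u v" "f u \<noteq> \<zero>\<^bsub>K\<^esub>" "g v \<noteq> \<zero>\<^bsub>K\<^esub>"
        using nz[OF t] by blast
      then have "magma_vars u \<subseteq> X" "magma_vars v \<subseteq> X"
        using f g unfolding free_nonassoc_carrier by blast+
      then show ?thesis using uv by simp
    qed
    moreover have "(f \<otimes>\<^bsub>?A\<^esub> g) t \<in> carrier K" for t
      using val[OF f] val[OF g] by (cases t) auto
    ultimately show ?thesis unfolding free_nonassoc_carrier by blast
  qed
  have "abelian_group ?A"
  proof (rule abelian_groupI)
    show "\<zero>\<^bsub>?A\<^esub> \<in> carrier ?A" by (simp add: free_nonassoc_carrier)
    fix f assume f: "f \<in> carrier ?A"
    show "\<exists>g\<in>carrier ?A. g \<oplus>\<^bsub>?A\<^esub> f = \<zero>\<^bsub>?A\<^esub>"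
    proof (intro bexI)
      show "((\<ominus>\<^bsub>K\<^esub> \<one>\<^bsub>K\<^esub>) \<odot>\<^bsub>?A\<^esub> f) \<oplus>\<^bsub>?A\<^esub> f = \<zero>\<^bsub>?A\<^esub>"
        using val[OF f] by (simp add: K.l_minus K.l_neg)
    qed (rule smult[OF _ f], simp)
  qed (use add val in \<open>auto simp: K.a_ac\<close>)
  then interpret M: module K ?A
    by (intro moduleI)
      (use smult val assms in \<open>auto simp: K.l_distr K.r_distr K.m_assoc\<close>)
  show ?thesis
    by unfold_locales
      (use mult val in \<open>auto simp: fun_eq_iff K.l_distr K.r_distr K.m_ac split: magma_term.split\<close>)
qed

lemma magma_delta_Bracket:
  assumes "cring K"
  shows "magma_delta K (Bracket s t) = magma_delta K s \<otimes>\<^bsub>free_nonassoc K X\<^esub> magma_delta K t"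
proof -
  interpret cring K by fact
  show ?thesis
    by (rule ext) (auto simp: magma_delta_def split: magma_term.split)
qed

lemma magma_delta_carrier:
  assumes "cring K" "magma_vars t \<subseteq> X"
  shows "magma_delta K t \<in> carrier (free_nonassoc K X)"
proof -
  interpret cring K by fact
  have "{s. magma_delta K t s \<noteq> \<zero>\<^bsub>K\<^esub>} \<subseteq> {t}"
    by (auto simp: magma_delta_def)
  then show ?thesis
    using assms(2) by (auto simp: free_nonassoc_carrier magma_delta_def intro: finite_subset)
qed

text \<open>
  The basis elements span: remove one term of the finite support at a time.
\<close>

lemma free_nonassoc_span:
  assumes "cring K" and N: "submodule N K (free_nonassoc K X)"
    and delta: "\<And>t. magma_vars t \<subseteq> X \<Longrightarrow> magma_delta K t \<in> N"
  shows "carrier (free_nonassoc K X) \<subseteq> N"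
proof
  let ?A = "free_nonassoc K X"
  interpret K: cring K by fact
  interpret A: nonassoc_algebra K ?A by (rule free_nonassoc_algebra) fact
  have step: "f \<in> N" if "finite S" "f \<in> carrier ?A" "{t. f t \<noteq> \<zero>\<^bsub>K\<^esub>} \<subseteq> S" for f S
    using that
  proof (induction S arbitrary: f)
    case empty
    then have "f = \<zero>\<^bsub>?A\<^esub>" by auto
    then show ?case using A.submodule_zero[OF N] by simp
  next
    case (insert t S)
    show ?case
    proof (cases "f t = \<zero>\<^bsub>K\<^esub>")
      case True
      then have "{t. f t \<noteq> \<zero>\<^bsub>K\<^esub>} \<subseteq> S" using insert.prems(2) by auto
      then show ?thesis using insert by blast
    next
      case False
      have val: "f s \<in> carrier K" for s using insert.prems by (simp add: free_nonassoc_carrier)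
      let ?g = "f(t := \<zero>\<^bsub>K\<^esub>)"
      have "{s. ?g s \<noteq> \<zero>\<^bsub>K\<^esub>} \<subseteq> {s. f s \<noteq> \<zero>\<^bsub>K\<^esub>}" by auto
      then have "?g \<in> carrier ?A"
        using insert.prems(1) by (auto simp: free_nonassoc_carrier intro: finite_subset)
      moreover have "{s. ?g s \<noteq> \<zero>\<^bsub>K\<^esub>} \<subseteq> S" using insert.prems(2) by auto
      ultimately have "?g \<in> N" by (rule insert.IH)
      moreover have "magma_delta K t \<in> N"
        using False insert.prems(1) by (intro delta) (auto simp: free_nonassoc_carrier)
      moreover have "f = ?g \<oplus>\<^bsub>?A\<^esub> f t \<odot>\<^bsub>?A\<^esub> magma_delta K t"
        using val by (auto simp: magma_delta_def)
      ultimately show ?thesis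
        using A.submodule_add[OF N] A.submodule_smult[OF N] val by metis
    qed
  qed
  fix f assume "f \<in> carrier ?A"
  then show "f \<in> N" by (intro step[of "{t. f t \<noteq> \<zero>\<^bsub>K\<^esub>}"]) (auto simp: free_nonassoc_carrier)
qed

lemma free_nonassoc_hom_unique:
  assumes Q: "nonassoc_algebra K Q"
    and e1: "e1 \<in> leibniz_hom K (free_nonassoc K X) Q"
    and e2: "e2 \<in> leibniz_hom K (free_nonassoc K X) Q"
    and vars: "\<And>x. x \<in> X \<Longrightarrow> e1 (magma_delta K (Var x)) = e2 (magma_delta K (Var x))"
    and f: "f \<in> carrier (free_nonassoc K X)"
  shows "e1 f = e2 f"
proof -
  let ?A = "free_nonassoc K X"
  interpret Q: nonassoc_algebra K Q by fact
  have K: "cring K" by (rule Q.R.is_cring)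
  interpret A: nonassoc_algebra K ?A by (rule free_nonassoc_algebra) fact
  interpret e1: nonassoc_hom K ?A Q e1 by unfold_locales fact
  interpret e2: nonassoc_hom K ?A Q e2 by unfold_locales fact
  let ?N = "{f \<in> carrier ?A. e1 f = e2 f}"
  have "submodule ?N K ?A"
    by (rule A.submodule_of_closed) (simp_all del: free_nonassoc_simps)
  moreover have "magma_delta K t \<in> ?N" if "magma_vars t \<subseteq> X" for t
    using that
  proof (induction t)
    case (Var x)
    then show ?case using vars magma_delta_carrier[OF K, of "Var x" X] by simp
  next
    case (Bracket s t)
    then show ?case
      unfolding magma_delta_Bracket[OF K, of s t X] by (simp del: free_nonassoc_simps)
  qed
  ultimately show ?thesis using free_nonassoc_span[OF K] f by blast
qed

text \<open>
  Freeness.  The extension \<open>e\<close> sends \<open>f\<close> to the finite sum of \<open>f t \<odot> magma_eval Q g t\<close> over its support.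
  Multiplicativity holds on pairs of basis elements because a product of monomials is a monomial;
  by bilinearity and \<open>free_nonassoc_span\<close> it spreads first to the left factor and then to the right
  one.  This avoids any rearrangement of double sums.
\<close>

lemma free_nonassoc_lift:
  fixes X :: "'x set"
  assumes Q: "nonassoc_algebra K Q" and g: "g \<in> UNIV \<rightarrow> carrier Q"
  obtains e where "e \<in> leibniz_hom K (free_nonassoc K X) Q"
    and "\<And>x. x \<in> X \<Longrightarrow> e (magma_delta K (Var x)) = g x"
proof -
  let ?A = "free_nonassoc K X"
  interpret Q: nonassoc_algebra K Q by fact
  have K: "cring K" by (rule Q.R.is_cring)
  interpret A: nonassoc_algebra K ?A by (rule free_nonassoc_algebra) fact
  let ?ev = "magma_eval Q g"
  let ?supp = "\<lambda>f. {t. f t \<noteq> \<zero>\<^bsub>K\<^esub>}"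
  have ev [simp]: "?ev t \<in> carrier Q" for t
    by (induction t) (use g in auto)
  define e where "e f = (\<Oplus>\<^bsub>Q\<^esub>t\<in>?supp f. f t \<odot>\<^bsub>Q\<^esub> ?ev t)" for f
  have val [simp]: "f t \<in> carrier K" if "f \<in> carrier ?A" for f t
    using that by (simp add: free_nonassoc_carrier)
  have fin [simp]: "finite (?supp f)" if "f \<in> carrier ?A" for f
    using that by (simp add: free_nonassoc_carrier)
  \<comment> \<open>A finite set containing the supports of both summands serves to prove additivity.\<close>
  have e_superset: "e f = (\<Oplus>\<^bsub>Q\<^esub>t\<in>S. f t \<odot>\<^bsub>Q\<^esub> ?ev t)"
    if f: "f \<in> carrier ?A" and S: "finite S" "?supp f \<subseteq> S" for f S
    unfolding e_def
    by (rule Q.add.finprod_mono_neutral_cong_left) (use f S in auto)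
  have closed [simp]: "e f \<in> carrier Q" if "f \<in> carrier ?A" for f
    unfolding e_def by (rule Q.finsum_closed) (use that in auto)
  have add: "e (f \<oplus>\<^bsub>?A\<^esub> f') = e f \<oplus>\<^bsub>Q\<^esub> e f'" if f: "f \<in> carrier ?A" "f' \<in> carrier ?A" for f f'
  proof -
    let ?S = "?supp f \<union> ?supp f'"
    have "e (f \<oplus>\<^bsub>?A\<^esub> f') = (\<Oplus>\<^bsub>Q\<^esub>t\<in>?S. (f \<oplus>\<^bsub>?A\<^esub> f') t \<odot>\<^bsub>Q\<^esub> ?ev t)"
      using f A.a_closed[OF f] by (intro e_superset) auto
    also have "\<dots> = (\<Oplus>\<^bsub>Q\<^esub>t\<in>?S. f t \<odot>\<^bsub>Q\<^esub> ?ev t \<oplus>\<^bsub>Q\<^esub> f' t \<odot>\<^bsub>Q\<^esub> ?ev t)"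
      using f by (intro Q.finsum_cong') (auto simp: Q.smult_l_distr)
    also have "\<dots> = (\<Oplus>\<^bsub>Q\<^esub>t\<in>?S. f t \<odot>\<^bsub>Q\<^esub> ?ev t) \<oplus>\<^bsub>Q\<^esub> (\<Oplus>\<^bsub>Q\<^esub>t\<in>?S. f' t \<odot>\<^bsub>Q\<^esub> ?ev t)"
      using f by (intro Q.finsum_addf) auto
    also have "\<dots> = e f \<oplus>\<^bsub>Q\<^esub> e f'"
      using f e_superset[of f ?S] e_superset[of f' ?S] by simp
    finally show ?thesis .
  qed
  have smult: "e (a \<odot>\<^bsub>?A\<^esub> f) = a \<odot>\<^bsub>Q\<^esub> e f" if f: "a \<in> carrier K" "f \<in> carrier ?A" for a f
  proof -
    have "e (a \<odot>\<^bsub>?A\<^esub> f) = (\<Oplus>\<^bsub>Q\<^esub>t\<in>?supp f. (a \<odot>\<^bsub>?A\<^esub> f) t \<odot>\<^bsub>Q\<^esub> ?ev t)"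
      using f A.smult_closed[OF f] by (intro e_superset) auto
    also have "\<dots> = (\<Oplus>\<^bsub>Q\<^esub>t\<in>?supp f. a \<odot>\<^bsub>Q\<^esub> (f t \<odot>\<^bsub>Q\<^esub> ?ev t))"
      using f by (intro Q.finsum_cong') (auto simp: Q.smult_assoc1)
    also have "\<dots> = a \<odot>\<^bsub>Q\<^esub> e f"
      unfolding e_def using f by (intro Q.finsum_smult_ldistr[symmetric]) auto
    finally show ?thesis .
  qed
  have zero: "e \<zero>\<^bsub>?A\<^esub> = \<zero>\<^bsub>Q\<^esub>"
    unfolding e_def by simp
  have delta: "e (magma_delta K t) = ?ev t" if t: "magma_vars t \<subseteq> X" for t
  proof -
    have "e (magma_delta K t) = (\<Oplus>\<^bsub>Q\<^esub>s\<in>{t}. magma_delta K t s \<odot>\<^bsub>Q\<^esub> ?ev s)"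
      by (rule e_superset) (use magma_delta_carrier[OF K t] in \<open>auto simp: magma_delta_def\<close>)
    then show ?thesis
      by (simp add: magma_delta_def)
  qed
  have mult_delta: "e (magma_delta K s \<otimes>\<^bsub>?A\<^esub> magma_delta K t) = e (magma_delta K s) \<otimes>\<^bsub>Q\<^esub> e (magma_delta K t)"
    if "magma_vars s \<subseteq> X" "magma_vars t \<subseteq> X" for s t
    using that unfolding magma_delta_Bracket[OF K, symmetric] by (simp add: delta)
  have mult_right: "carrier ?A \<subseteq> {f \<in> carrier ?A. e (f \<otimes>\<^bsub>?A\<^esub> magma_delta K t) = e f \<otimes>\<^bsub>Q\<^esub> e (magma_delta K t)}"
    if t: "magma_vars t \<subseteq> X" for t
  proof (rule free_nonassoc_span[OF K])
    have d: "magma_delta K t \<in> carrier ?A" by (rule magma_delta_carrier[OF K t])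
    show "submodule {f \<in> carrier ?A. e (f \<otimes>\<^bsub>?A\<^esub> magma_delta K t) = e f \<otimes>\<^bsub>Q\<^esub> e (magma_delta K t)} K ?A"
      by (rule A.submodule_of_closed)
        (use d in \<open>auto simp del: free_nonassoc_simps
          simp: zero add smult A.bracket_l_distr Q.bracket_l_distr A.bracket_smult_l Q.bracket_smult_l\<close>)
  qed (use mult_delta t magma_delta_carrier[OF K] in auto)
  have mult: "carrier ?A \<subseteq> {f' \<in> carrier ?A. e (f \<otimes>\<^bsub>?A\<^esub> f') = e f \<otimes>\<^bsub>Q\<^esub> e f'}"
    if f: "f \<in> carrier ?A" for f
  proof (rule free_nonassoc_span[OF K])
    show "submodule {f' \<in> carrier ?A. e (f \<otimes>\<^bsub>?A\<^esub> f') = e f \<otimes>\<^bsub>Q\<^esub> e f'} K ?A"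
      by (rule A.submodule_of_closed)
        (use f in \<open>auto simp del: free_nonassoc_simps
          simp: zero add smult A.bracket_r_distr Q.bracket_r_distr A.bracket_smult_r Q.bracket_smult_r\<close>)
  qed (use mult_right f magma_delta_carrier[OF K] in auto)
  show thesis
  proof
    show "e \<in> leibniz_hom K ?A Q"
      unfolding leibniz_hom_def using add smult subsetD[OF mult]
      by (auto simp del: free_nonassoc_simps)
    show "e (magma_delta K (Var x)) = g x" if "x \<in> X" for x
      using delta[of "Var x"] that by simp
  qed
qed

section \<open>Free Leibniz algebras are projective\<close>

text \<open>
  The defining intersection is over a nonempty family, since the whole algebra belongs to it.
\<close>

lemma leibniz_relations_ideal:
  assumes "cring K" shows "two_sided_ideal K (free_nonassoc K X) (leibniz_relations K X)"
proof -
  let ?A = "free_nonassoc K X"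
  interpret A: nonassoc_algebra K ?A by (rule free_nonassoc_algebra) fact
  let ?I = "{I. two_sided_ideal K ?A I \<and>
        (\<forall>x\<in>carrier ?A. \<forall>y\<in>carrier ?A. \<forall>z\<in>carrier ?A.
           (x \<otimes>\<^bsub>?A\<^esub> (y \<otimes>\<^bsub>?A\<^esub> z)) \<ominus>\<^bsub>?A\<^esub> (((x \<otimes>\<^bsub>?A\<^esub> y) \<otimes>\<^bsub>?A\<^esub> z) \<ominus>\<^bsub>?A\<^esub> ((x \<otimes>\<^bsub>?A\<^esub> z) \<otimes>\<^bsub>?A\<^esub> y)) \<in> I)}"
  have "carrier ?A \<in> ?I"
    using A.carrier_is_submodule unfolding two_sided_ideal_def
    by (auto simp del: free_nonassoc_simps)
  then have "submodule (\<Inter>?I) K ?A"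
    by (intro A.submodule_Inter) (auto simp: two_sided_ideal_def)
  then have "two_sided_ideal K ?A (\<Inter>?I)"
    unfolding two_sided_ideal_def by (blast)
  then show ?thesis unfolding leibniz_relations_def Let_def .
qed

text \<open>
  The kernel of \<open>e\<close> is an ideal containing the Leibniz relations, because \<open>G\<close> satisfies them.
\<close>

lemma leibniz_relations_vanish:
  assumes "leibniz_algebra K G" and e: "e \<in> leibniz_hom K (free_nonassoc K X) G"
  shows "leibniz_relations K X \<subseteq> a_kernel (free_nonassoc K X) G e"
proof -
  let ?A = "free_nonassoc K X"
  interpret G: nonassoc_algebra K G by (rule leibniz_algebra_nonassoc) fact
  interpret A: nonassoc_algebra K ?A by (rule free_nonassoc_algebra) (rule G.R.is_cring)
  interpret e: nonassoc_hom K ?A G e by unfold_locales fact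
  have "x \<otimes>\<^bsub>?A\<^esub> (y \<otimes>\<^bsub>?A\<^esub> z) \<ominus>\<^bsub>?A\<^esub> (x \<otimes>\<^bsub>?A\<^esub> y \<otimes>\<^bsub>?A\<^esub> z \<ominus>\<^bsub>?A\<^esub> x \<otimes>\<^bsub>?A\<^esub> z \<otimes>\<^bsub>?A\<^esub> y) \<in> a_kernel ?A G e"
    if "x \<in> carrier ?A" "y \<in> carrier ?A" "z \<in> carrier ?A" for x y z
    using that leibniz_algebra.leibniz_identity[OF assms(1), of "e x" "e y" "e z"] G.r_neg
    by (simp add: a_kernel_def' a_minus_def[of G "_ \<ominus>\<^bsub>G\<^esub> _"] del: free_nonassoc_simps)
  then show ?thesis
    using e.kernel_ideal unfolding leibniz_relations_def Let_def by blast
qed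

text \<open>
  Choose preimages in \<open>G\<close> of the values of \<open>p\<close> on the free generators \<open>X\<close> and extend them to the free
  nonassociative algebra; the extension \<open>e\<close> kills the Leibniz relations, hence factors through the
  projection \<open>\<pi>\<close> onto \<open>F\<close>.  The factor lifts \<open>p\<close> because \<open>h \<circ> e\<close> and \<open>p \<circ> \<pi>\<close> agree on the variables.
\<close>

lemma free_leibniz_projective:
  assumes F: "is_free_leibniz K F" and G: "leibniz_algebra K G" and Q: "leibniz_algebra K Q"
    and h: "h \<in> leibniz_epi K G Q" and p: "p \<in> leibniz_hom K F Q"
  obtains \<sigma> where "\<sigma> \<in> leibniz_hom K F G" and "\<And>y. y \<in> carrier F \<Longrightarrow> h (\<sigma> y) = p y"
proof -
  obtain X \<theta> where X: "X \<subseteq> carrier F" and \<theta>: "\<theta> \<in> leibniz_iso K (free_leibniz K X) F"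
    and gen: "\<And>x. x \<in> X \<Longrightarrow> \<theta> (free_leibniz_gen K X x) = x"
    using F unfolding is_free_leibniz_def by blast
  let ?A = "free_nonassoc K X" and ?I = "leibniz_relations K X"
  interpret G: nonassoc_algebra K G by (rule leibniz_algebra_nonassoc) fact
  interpret Q: nonassoc_algebra K Q by (rule leibniz_algebra_nonassoc) fact
  have K: "cring K" by (rule G.R.is_cring)
  interpret A: nonassoc_algebra K ?A by (rule free_nonassoc_algebra) fact
  have hhom: "h \<in> leibniz_hom K G Q" and onto: "h ` carrier G = carrier Q"
    using h unfolding leibniz_epi_def by auto
  define \<pi> where "\<pi> f = \<theta> (?I +>\<^bsub>?A\<^esub> f)" for f
  have I: "two_sided_ideal K ?A ?I" by (rule leibniz_relations_ideal) fact
  have c: "(\<lambda>f. ?I +>\<^bsub>?A\<^esub> f) \<in> leibniz_epi K ?A (free_leibniz K X)"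
    unfolding free_leibniz_def by (rule A.coset_map_epi) fact
  have \<pi>: "\<pi> \<in> leibniz_epi K ?A F"
  proof -
    have "(\<lambda>f. ?I +>\<^bsub>?A\<^esub> f) \<in> leibniz_hom K ?A (free_leibniz K X)"
      using c unfolding leibniz_epi_def by blast
    moreover have "\<theta> \<in> leibniz_hom K (free_leibniz K X) F"
      using \<theta> unfolding leibniz_iso_def by blast
    ultimately have "\<pi> \<in> leibniz_hom K ?A F"
      unfolding \<pi>_def by (rule leibniz_hom_comp)
    moreover have "\<pi> ` carrier ?A = \<theta> ` ((\<lambda>f. ?I +>\<^bsub>?A\<^esub> f) ` carrier ?A)"
      unfolding \<pi>_def by auto
    ultimately show ?thesis
      using c \<theta> by (simp add: leibniz_epi_def leibniz_iso_def bij_betw_def)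
  qed
  have \<pi>_var: "\<pi> (magma_delta K (Var x)) = x" if "x \<in> X" for x
    using gen[OF that] unfolding \<pi>_def free_leibniz_gen_def magma_delta_def .
  have \<pi>_eq: "f \<ominus>\<^bsub>?A\<^esub> f' \<in> ?I" if "f \<in> carrier ?A" "f' \<in> carrier ?A" "\<pi> f = \<pi> f'" for f f'
  proof -
    have "?I +>\<^bsub>?A\<^esub> f \<in> carrier (free_leibniz K X)" "?I +>\<^bsub>?A\<^esub> f' \<in> carrier (free_leibniz K X)"
      using c that unfolding leibniz_epi_def by auto
    then have "?I +>\<^bsub>?A\<^esub> f = ?I +>\<^bsub>?A\<^esub> f'"
      using \<theta> that(3) unfolding \<pi>_def leibniz_iso_def bij_betw_def by (auto dest: inj_onD)
    then show ?thesis
      using A.coset_eq_iff that I unfolding two_sided_ideal_def by blast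
  qed
  \<comment> \<open>Off \<open>X\<close> the value \<open>\<zero>\<close> serves only to make \<open>g\<close> a total function into the carrier.\<close>
  define g where "g x = (if x \<in> X then SOME y. y \<in> carrier G \<and> h y = p x else \<zero>\<^bsub>G\<^esub>)" for x
  have g: "g x \<in> carrier G \<and> h (g x) = p x" if "x \<in> X" for x
  proof -
    have "p x \<in> h ` carrier G" using that X p onto unfolding leibniz_hom_def by auto
    then have "\<exists>y. y \<in> carrier G \<and> h y = p x" by auto
    then show ?thesis unfolding g_def using that someI_ex by simp
  qed
  have "g \<in> UNIV \<rightarrow> carrier G"
    using g by (auto simp: g_def)
  then obtain e where e: "e \<in> leibniz_hom K ?A G"
    and e_var: "\<And>x. x \<in> X \<Longrightarrow> e (magma_delta K (Var x)) = g x"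
    using free_nonassoc_lift[OF leibniz_algebra_nonassoc[OF G]] by metis
  interpret e: nonassoc_hom K ?A G e by unfold_locales fact
  have "e f = e f'" if ff: "f \<in> carrier ?A" "f' \<in> carrier ?A" "\<pi> f = \<pi> f'" for f f'
  proof -
    have "e (f \<ominus>\<^bsub>?A\<^esub> f') = \<zero>\<^bsub>G\<^esub>"
      using \<pi>_eq[OF ff] leibniz_relations_vanish[OF G e] by (auto simp: a_kernel_def')
    then show ?thesis using ff by (simp add: G.minus_eq_zero_iff)
  qed
  then obtain \<sigma> where \<sigma>: "\<sigma> \<in> leibniz_hom K F G" "\<And>f. f \<in> carrier ?A \<Longrightarrow> \<sigma> (\<pi> f) = e f"
    using leibniz_hom_factor[OF \<pi> e] A.nonassoc_algebra_axioms by blast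
  show thesis
  proof
    show "\<sigma> \<in> leibniz_hom K F G" by fact
    fix y assume "y \<in> carrier F"
    then obtain f where f: "f \<in> carrier ?A" "y = \<pi> f"
      using \<pi> unfolding leibniz_epi_def by auto
    have "h (e f) = p (\<pi> f)"
    proof (rule free_nonassoc_hom_unique[OF leibniz_algebra_nonassoc[OF Q] _ _ _ f(1)])
      show "(\<lambda>f. h (e f)) \<in> leibniz_hom K ?A Q" using e hhom by (rule leibniz_hom_comp)
      show "(\<lambda>f. p (\<pi> f)) \<in> leibniz_hom K ?A Q"
        using \<pi> p leibniz_hom_comp unfolding leibniz_epi_def by blast
    qed (use e_var g \<pi>_var in auto)
    then show "h (\<sigma> y) = p y" using f \<sigma> by simp
  qed
qed

section \<open>Surjectivity\<close>

text \<open>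
  Descent along the chain \<open>M\<close>, with invariant \<open>Q = h(P) + M\<^sub>i\<close>.  A commutator of \<open>h x + m\<close> and
  \<open>h y + n\<close> differs from the image of the commutator of \<open>x\<close> and \<open>y\<close> by commutators with \<open>m\<close> and \<open>n\<close>, which
  lie one step further down; these commutators exhaust the annihilator, and with \<open>h(P)\<close> all of \<open>Q\<close>.
\<close>

lemma (in nonassoc_hom) surj_of_lie_quot_surj:
  assumes half: "\<one>\<^bsub>K\<^esub> \<oplus>\<^bsub>K\<^esub> \<one>\<^bsub>K\<^esub> \<in> Units K"
    and nil: "lie_nilpotent K Q"
    and lie: "lie_quot_map K Q h ` carrier (lie_quot K P) = carrier (lie_quot K Q)"
  shows "h ` carrier P = carrier Q"
proof -
  obtain k M where M0: "M 0 = {\<zero>\<^bsub>Q\<^esub>}" and Mk: "M k = carrier Q"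
    and ideal: "\<And>i. i \<le> k \<Longrightarrow> two_sided_ideal K Q (M i)"
    and comm: "\<And>i. i < k \<Longrightarrow> lie_commutator K Q (M (Suc i)) (carrier Q) \<subseteq> M i"
    using nil unfolding lie_nilpotent_def by metis
  let ?S = "\<lambda>i. set_add Q (h ` carrier P) (M i)"
  have sub: "submodule (M i) K Q" if "i \<le> k" for i
    using ideal[OF that] unfolding two_sided_ideal_def by blast
  have im: "submodule (h ` carrier P) K Q"
    by (rule image_submodule) (rule P.carrier_is_submodule)
  have S: "submodule (?S i) K Q" if "i \<le> k" for i
    by (rule Q.submodule_add_set[OF im sub[OF that]])
  have imS: "h x \<in> ?S i" if "x \<in> carrier P" "i \<le> k" for x i
  proof -
    have "h x \<oplus>\<^bsub>Q\<^esub> \<zero>\<^bsub>Q\<^esub> \<in> ?S i"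
      using that Q.submodule_zero[OF sub[OF that(2)]] unfolding set_add_def' by blast
    then show ?thesis using that by simp
  qed
  have MS: "m \<in> ?S i" if "m \<in> M i" "i \<le> k" for m i
  proof -
    have "h \<zero>\<^bsub>P\<^esub> \<oplus>\<^bsub>Q\<^esub> m \<in> ?S i"
      using that unfolding set_add_def' by blast
    then show ?thesis using that Q.submodule_subset[OF sub[OF that(2)]] by auto
  qed
  have split: "\<exists>a\<in>leib_ann K Q. \<exists>x\<in>carrier P. q = a \<oplus>\<^bsub>Q\<^esub> h x" if q: "q \<in> carrier Q" for q
  proof -
    interpret ann: abelian_subgroup "leib_ann K Q" Q
      by (rule Q.submodule_abelian_subgroup[OF Q.leib_ann_submodule])
    have annP: "leib_ann K P \<subseteq> carrier P" by (rule P.submodule_subset[OF P.leib_ann_submodule])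
    have "leib_ann K Q +>\<^bsub>Q\<^esub> q \<in> carrier (lie_quot K Q)"
      unfolding lie_quot_def alg_quot_def by (simp add: Q.a_rcosetsI[OF ann.a_subset q])
    then obtain A where A: "A \<in> carrier (lie_quot K P)"
      and eq: "leib_ann K Q +>\<^bsub>Q\<^esub> q = lie_quot_map K Q h A"
      using lie by blast
    have "q \<in> lie_quot_map K Q h A"
      using ann.a_rcos_self[OF q] eq by simp
    then obtain x where x: "x \<in> A" "q \<in> leib_ann K Q +>\<^bsub>Q\<^esub> h x"
      unfolding lie_quot_map_def quot_map_def by blast
    have "x \<in> carrier P"
      using A x(1) annP unfolding lie_quot_def alg_quot_def
      by (auto simp: A_RCOSETS_def' a_r_coset_def' intro: P.a_closed)
    then show ?thesis using x(2) unfolding a_r_coset_def' by blast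
  qed
  have step: "carrier Q \<subseteq> ?S i" if i: "i < k" and IH: "carrier Q \<subseteq> ?S (Suc i)" for i
  proof -
    have i': "i \<le> k" "Suc i \<le> k" using i by auto
    have MQ: "m \<in> carrier Q" if "m \<in> M (Suc i)" for m
      using that Q.submodule_subset[OF sub[OF i'(2)]] by blast
    have comm': "m \<otimes>\<^bsub>Q\<^esub> q \<oplus>\<^bsub>Q\<^esub> q \<otimes>\<^bsub>Q\<^esub> m \<in> ?S i" if "m \<in> M (Suc i)" "q \<in> carrier Q" for m q
      using lie_commutator_gen[OF that] comm[OF i] MS[OF _ i'(1)] by blast
    have "lie_commutator K Q (carrier Q) (carrier Q) \<subseteq> ?S i"
    proof (rule lie_commutator_least[OF S[OF i'(1)]])
      fix a b assume a: "a \<in> carrier Q" and b: "b \<in> carrier Q"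
      obtain x m where x: "x \<in> carrier P" and m: "m \<in> M (Suc i)" and a_eq: "a = h x \<oplus>\<^bsub>Q\<^esub> m"
        using a IH unfolding set_add_def' by blast
      obtain y n where y: "y \<in> carrier P" and n: "n \<in> M (Suc i)" and b_eq: "b = h y \<oplus>\<^bsub>Q\<^esub> n"
        using b IH unfolding set_add_def' by blast
      have "a \<otimes>\<^bsub>Q\<^esub> b \<oplus>\<^bsub>Q\<^esub> b \<otimes>\<^bsub>Q\<^esub> a =
          h (x \<otimes>\<^bsub>P\<^esub> y \<oplus>\<^bsub>P\<^esub> y \<otimes>\<^bsub>P\<^esub> x) \<oplus>\<^bsub>Q\<^esub> (n \<otimes>\<^bsub>Q\<^esub> h x \<oplus>\<^bsub>Q\<^esub> h x \<otimes>\<^bsub>Q\<^esub> n)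
            \<oplus>\<^bsub>Q\<^esub> (m \<otimes>\<^bsub>Q\<^esub> b \<oplus>\<^bsub>Q\<^esub> b \<otimes>\<^bsub>Q\<^esub> m)"
        unfolding a_eq b_eq using x y MQ[OF m] MQ[OF n]
        by (simp add: Q.bracket_l_distr Q.bracket_r_distr Q.a_ac)
      also have "\<dots> \<in> ?S i"
        using x y m n b by (intro Q.submodule_add[OF S[OF i'(1)]] comm' imS i'(1)) auto
      finally show "a \<otimes>\<^bsub>Q\<^esub> b \<oplus>\<^bsub>Q\<^esub> b \<otimes>\<^bsub>Q\<^esub> a \<in> ?S i" .
    qed
    then have ann: "leib_ann K Q \<subseteq> ?S i"
      using Q.leib_ann_subset_commutator[OF half] by blast
    show ?thesis
    proof
      fix q assume "q \<in> carrier Q"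
      then obtain a x where "a \<in> leib_ann K Q" "x \<in> carrier P" "q = a \<oplus>\<^bsub>Q\<^esub> h x"
        using split by blast
      then show "q \<in> ?S i"
        using ann imS[OF _ i'(1)] Q.submodule_add[OF S[OF i'(1)]] by blast
    qed
  qed
  have "carrier Q \<subseteq> ?S 0"
  proof (rule inc_induct[of 0 k "\<lambda>i. carrier Q \<subseteq> ?S i"])
    show "carrier Q \<subseteq> ?S k" using MS[of _ k] Mk by blast
  qed (use step in auto)
  then show ?thesis
    unfolding M0 set_add_def' by auto
qed

section \<open>Injectivity\<close>

lemma (in nonassoc_hom) kernel_subset_leib_ann:
  assumes "inj_on (lie_quot_map K Q h) (carrier (lie_quot K P))"
  shows "a_kernel P Q h \<subseteq> leib_ann K P"
proof
  interpret annP: abelian_subgroup "leib_ann K P" P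
    by (rule P.submodule_abelian_subgroup[OF P.leib_ann_submodule])
  interpret annQ: abelian_subgroup "leib_ann K Q" Q
    by (rule Q.submodule_abelian_subgroup[OF Q.leib_ann_submodule])
  fix x assume "x \<in> a_kernel P Q h"
  then have x: "x \<in> carrier P" "h x = \<zero>\<^bsub>Q\<^esub>" by (auto simp: a_kernel_def')
  have val: "lie_quot_map K Q h (leib_ann K P +>\<^bsub>P\<^esub> y) = leib_ann K Q"
    if y: "y \<in> carrier P" "h y = \<zero>\<^bsub>Q\<^esub>" for y
  proof -
    have "leib_ann K Q +>\<^bsub>Q\<^esub> h z = leib_ann K Q" if z: "z \<in> leib_ann K P +>\<^bsub>P\<^esub> y" for z
    proof -
      obtain i where i: "i \<in> leib_ann K P" "z = i \<oplus>\<^bsub>P\<^esub> y" using z unfolding a_r_coset_def' by blast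
      then have "h z = h i" using y annP.a_subset by auto
      then show ?thesis
        using hom_leib_ann[OF i(1)] annQ.a_rcos_const by simp
    qed
    then show ?thesis
      unfolding lie_quot_map_def quot_map_def
      by (intro UN_constant_eq[OF annP.a_rcos_self[OF y(1)]] ballI)
  qed
  have mem: "leib_ann K P +>\<^bsub>P\<^esub> y \<in> carrier (lie_quot K P)" if "y \<in> carrier P" for y
    unfolding lie_quot_def alg_quot_def by (simp add: P.a_rcosetsI[OF annP.a_subset that])
  have "leib_ann K P +>\<^bsub>P\<^esub> x = leib_ann K P +>\<^bsub>P\<^esub> \<zero>\<^bsub>P\<^esub>"
    by (rule inj_onD[OF assms]) (simp_all add: val x mem)
  then show "x \<in> leib_ann K P"
    using x(1) annP.a_rcos_self[OF x(1)] annP.a_subset by simp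
qed

text \<open>
  A Nakayama-type statement: if \<open>N \<subseteq> M\<^sub>i\<^sub>+\<^sub>1\<close> for a nilpotency chain \<open>M\<close>, then
  \<open>N \<subseteq> [N,Q]\<^sub>L \<subseteq> [M\<^sub>i\<^sub>+\<^sub>1,Q]\<^sub>L \<subseteq> M\<^sub>i\<close>.
\<close>

lemma (in nonassoc_algebra) subset_zero_of_lie_nilpotent:
  assumes nil: "lie_nilpotent K Q" and sub: "N \<subseteq> carrier Q"
    and N: "N \<subseteq> lie_commutator K Q N (carrier Q)"
  shows "N \<subseteq> {\<zero>}"
proof -
  obtain k M where M0: "M 0 = {\<zero>}" and Mk: "M k = carrier Q"
    and comm: "\<And>i. i < k \<Longrightarrow> lie_commutator K Q (M (Suc i)) (carrier Q) \<subseteq> M i"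
    using nil unfolding lie_nilpotent_def by metis
  have "N \<subseteq> M 0"
  proof (rule inc_induct[of 0 k "\<lambda>i. N \<subseteq> M i"])
    fix i assume "i < k" "N \<subseteq> M (Suc i)"
    then show "N \<subseteq> M i"
      using N comm lie_commutator_mono[of N "M (Suc i)" "carrier Q" "carrier Q" K Q] by blast
  qed (use sub Mk in auto)
  then show ?thesis using M0 by simp
qed

text \<open>
  Surjectivity on second homology, read on representatives.  A coset that maps to the class of \<open>y\<close>
  contains some \<open>r\<close> with \<open>\<psi> r\<close> congruent to \<open>y\<close>, and \<open>r\<close> lies in the numerator of the quotient because
  the denominator does.
\<close>

lemma HL2_Lie_surj_lift:
  assumes F: "nonassoc_algebra K F" and F': "nonassoc_algebra K F'"
    and R: "two_sided_ideal K F R" and R': "two_sided_ideal K F' R'"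
    and epi: "HL2_Lie_map K F' R' \<psi> \<in> leibniz_epi K (HL2_Lie K F R) (HL2_Lie K F' R')"
    and y: "y \<in> R' \<inter> lie_commutator K F' (carrier F') (carrier F')"
  obtains r where "r \<in> R \<inter> lie_commutator K F (carrier F) (carrier F)"
    and "\<exists>c\<in>lie_commutator K F' R' (carrier F'). y = c \<oplus>\<^bsub>F'\<^esub> \<psi> r"
proof -
  interpret F: nonassoc_algebra K F by fact
  interpret F': nonassoc_algebra K F' by fact
  let ?C = "lie_commutator K F R (carrier F)" and ?C' = "lie_commutator K F' R' (carrier F')"
  let ?D = "lie_commutator K F (carrier F) (carrier F)"
  let ?D' = "lie_commutator K F' (carrier F') (carrier F')"
  have Rs: "submodule R K F" and R's: "submodule R' K F'"
    using R R' unfolding two_sided_ideal_def by blast+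
  have D: "submodule ?D K F"
    by (rule F.lie_commutator_submodule[OF subset_refl subset_refl])
  have C': "submodule ?C' K F'"
    by (rule F'.lie_commutator_submodule[OF F'.submodule_subset[OF R's] subset_refl])
  have Csub: "?C \<subseteq> R \<inter> ?D"
    using F.lie_commutator_ideal_subset[OF R] F.submodule_subset[OF Rs]
      lie_commutator_mono[of R "carrier F" "carrier F" "carrier F" K F] by simp
  interpret C': abelian_subgroup ?C' F' by (rule F'.submodule_abelian_subgroup[OF C'])
  have y': "y \<in> carrier F'" using y F'.submodule_subset[OF R's] by blast
  have "?C' +>\<^bsub>F'\<^esub> y \<in> carrier (HL2_Lie K F' R')"
    using y unfolding HL2_Lie_def alg_quot_def by (auto simp: A_RCOSETS_def' a_r_coset_def')
  then obtain A where A: "A \<in> carrier (HL2_Lie K F R)" and eq: "?C' +>\<^bsub>F'\<^esub> y = HL2_Lie_map K F' R' \<psi> A"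
    using epi unfolding leibniz_epi_def by blast
  have "y \<in> HL2_Lie_map K F' R' \<psi> A"
    using C'.a_rcos_self[OF y'] eq by simp
  then obtain r where r: "r \<in> A" "y \<in> ?C' +>\<^bsub>F'\<^esub> \<psi> r"
    unfolding HL2_Lie_map_def quot_map_def by blast
  obtain c s where cs: "c \<in> ?C" "s \<in> R \<inter> ?D" "r = c \<oplus>\<^bsub>F\<^esub> s"
    using A r(1) unfolding HL2_Lie_def alg_quot_def by (auto simp: A_RCOSETS_def' a_r_coset_def')
  have "r \<in> R \<inter> ?D"
    using cs Csub F.submodule_add[OF Rs] F.submodule_add[OF D] by blast
  moreover have "\<exists>c\<in>?C'. y = c \<oplus>\<^bsub>F'\<^esub> \<psi> r"
    using r(2) unfolding a_r_coset_def' by blast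
  ultimately show thesis by (rule that)
qed

text \<open>
  Two homomorphisms that agree modulo an ideal \<open>N\<close> agree modulo \<open>[N,G]\<^sub>L\<close> on commutators: with
  \<open>s a = m + t a\<close> and \<open>s b = n + t b\<close>, where \<open>m, n \<in> N\<close>, bilinearity gives
  \<open>[s a, s b]\<^sub>L = [m, s b]\<^sub>L + [n, t a]\<^sub>L + [t a, t b]\<^sub>L\<close>.
\<close>

lemma hom_diff_lie_commutator:
  assumes s: "nonassoc_hom K F G s" and t: "nonassoc_hom K F G t"
    and N: "two_sided_ideal K G N"
    and diff: "\<And>a. a \<in> carrier F \<Longrightarrow> s a \<ominus>\<^bsub>G\<^esub> t a \<in> N"
    and f: "f \<in> lie_commutator K F (carrier F) (carrier F)"
  shows "s f \<ominus>\<^bsub>G\<^esub> t f \<in> lie_commutator K G N (carrier G)"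
proof -
  interpret s: nonassoc_hom K F G s by fact
  interpret t: nonassoc_hom K F G t by fact
  let ?C = "lie_commutator K G N (carrier G)"
  have Ns: "N \<subseteq> carrier G"
    using N s.Q.submodule_subset unfolding two_sided_ideal_def by blast
  have C: "submodule ?C K G" by (rule s.Q.lie_commutator_submodule[OF Ns subset_refl])
  have C_sub: "c \<in> carrier G" if "c \<in> ?C" for c
    using that s.Q.submodule_subset[OF C] by blast
  let ?U = "{f \<in> carrier F. s f \<ominus>\<^bsub>G\<^esub> t f \<in> ?C}"
  have "submodule ?U K F"
  proof (rule s.P.submodule_of_closed)
    show "\<zero>\<^bsub>F\<^esub> \<in> ?U"
      using s.Q.submodule_zero[OF C] by (simp add: a_minus_def s.Q.r_neg)
    fix x y assume xy: "x \<in> ?U" "y \<in> ?U"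
    have "s (x \<oplus>\<^bsub>F\<^esub> y) \<ominus>\<^bsub>G\<^esub> t (x \<oplus>\<^bsub>F\<^esub> y) = (s x \<ominus>\<^bsub>G\<^esub> t x) \<oplus>\<^bsub>G\<^esub> (s y \<ominus>\<^bsub>G\<^esub> t y)"
      using xy by (simp add: a_minus_def s.Q.minus_add s.Q.a_ac)
    then show "x \<oplus>\<^bsub>F\<^esub> y \<in> ?U" using xy s.Q.submodule_add[OF C] by simp
  next
    fix a x assume ax: "a \<in> carrier K" "x \<in> ?U"
    have "s (a \<odot>\<^bsub>F\<^esub> x) \<ominus>\<^bsub>G\<^esub> t (a \<odot>\<^bsub>F\<^esub> x) = a \<odot>\<^bsub>G\<^esub> (s x \<ominus>\<^bsub>G\<^esub> t x)"
      using ax by (simp add: a_minus_def s.Q.smult_r_distr s.Q.smult_r_minus)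
    then show "a \<odot>\<^bsub>F\<^esub> x \<in> ?U" using ax s.Q.submodule_smult[OF C] by simp
  qed auto
  moreover have "a \<otimes>\<^bsub>F\<^esub> b \<oplus>\<^bsub>F\<^esub> b \<otimes>\<^bsub>F\<^esub> a \<in> ?U" if ab: "a \<in> carrier F" "b \<in> carrier F" for a b
  proof -
    define m n where "m = s a \<ominus>\<^bsub>G\<^esub> t a" and "n = s b \<ominus>\<^bsub>G\<^esub> t b"
    have mn: "m \<in> N" "n \<in> N" using diff ab by (auto simp: m_def n_def)
    then have mn': "m \<in> carrier G" "n \<in> carrier G" using Ns by auto
    have sa: "s a = m \<oplus>\<^bsub>G\<^esub> t a" and sb: "s b = n \<oplus>\<^bsub>G\<^esub> t b"
      using ab by (simp_all add: m_def n_def a_minus_def s.Q.a_assoc s.Q.l_neg)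
    let ?c = "(m \<otimes>\<^bsub>G\<^esub> s b \<oplus>\<^bsub>G\<^esub> s b \<otimes>\<^bsub>G\<^esub> m) \<oplus>\<^bsub>G\<^esub> (n \<otimes>\<^bsub>G\<^esub> t a \<oplus>\<^bsub>G\<^esub> t a \<otimes>\<^bsub>G\<^esub> n)"
    have c: "?c \<in> ?C"
      using mn ab by (intro s.Q.submodule_add[OF C] lie_commutator_gen) auto
    have "s (a \<otimes>\<^bsub>F\<^esub> b \<oplus>\<^bsub>F\<^esub> b \<otimes>\<^bsub>F\<^esub> a) = ?c \<oplus>\<^bsub>G\<^esub> t (a \<otimes>\<^bsub>F\<^esub> b \<oplus>\<^bsub>F\<^esub> b \<otimes>\<^bsub>F\<^esub> a)"
      using ab mn' by (simp add: sa sb s.Q.bracket_l_distr s.Q.bracket_r_distr s.Q.a_ac)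
    then have "s (a \<otimes>\<^bsub>F\<^esub> b \<oplus>\<^bsub>F\<^esub> b \<otimes>\<^bsub>F\<^esub> a) \<ominus>\<^bsub>G\<^esub> t (a \<otimes>\<^bsub>F\<^esub> b \<oplus>\<^bsub>F\<^esub> b \<otimes>\<^bsub>F\<^esub> a) = ?c"
      using ab C_sub[OF c] by (simp add: a_minus_def s.Q.a_assoc s.Q.r_neg del: s.hom_add t.hom_add s.hom_bracket t.hom_bracket)
    then show ?thesis using c ab by simp
  qed
  ultimately have "lie_commutator K F (carrier F) (carrier F) \<subseteq> ?U"
    by (rule lie_commutator_least)
  then show ?thesis using f by blast
qed

text \<open>
  If \<open>x = p f\<close>, surjectivity on homology corrects \<open>f\<close> by an element \<open>r\<close> of the kernel of \<open>p\<close> so that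
  \<open>\<psi> (f - r) \<in> [R',F']\<^sub>L\<close>.  A lift \<open>\<sigma>\<close> of \<open>p'\<close> along \<open>\<phi>\<close> sends this to \<open>[N,G]\<^sub>L\<close>, and \<open>\<sigma> \<circ> \<psi>\<close> agrees
  with \<open>p\<close> modulo \<open>N\<close>, hence modulo \<open>[N,G]\<^sub>L\<close> at \<open>f - r\<close>.
\<close>

lemma kernel_subset_commutator_of_HL2_epi:
  assumes G: "leibniz_algebra K G" and Q: "leibniz_algebra K Q"
    and h: "\<phi> \<in> leibniz_epi K G Q"
    and pres: "free_presentation K F p G" "free_presentation K F' p' Q"
    and \<psi>: "\<psi> \<in> leibniz_hom K F F'" and lift: "\<And>x. x \<in> carrier F \<Longrightarrow> p' (\<psi> x) = \<phi> (p x)"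
    and epi: "HL2_Lie_map K F' (a_kernel F' Q p') \<psi> \<in>
           leibniz_epi K (HL2_Lie K F (a_kernel F G p)) (HL2_Lie K F' (a_kernel F' Q p'))"
    and ker: "a_kernel G Q \<phi> \<subseteq> lie_commutator K G (carrier G) (carrier G)"
  shows "a_kernel G Q \<phi> \<subseteq> lie_commutator K G (a_kernel G Q \<phi>) (carrier G)"
proof
  have F: "leibniz_algebra K F" and F': "leibniz_algebra K F'"
    and p: "p \<in> leibniz_hom K F G" "p ` carrier F = carrier G" and p': "p' \<in> leibniz_hom K F' Q"
    and free: "is_free_leibniz K F'" and \<phi>: "\<phi> \<in> leibniz_hom K G Q"
    using pres h unfolding free_presentation_def is_free_leibniz_def leibniz_epi_def by auto
  let ?N = "a_kernel G Q \<phi>" and ?R = "a_kernel F G p" and ?R' = "a_kernel F' Q p'"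
  let ?C = "lie_commutator K G ?N (carrier G)" and ?C' = "lie_commutator K F' ?R' (carrier F')"
  let ?D = "lie_commutator K F (carrier F) (carrier F)"
  obtain \<sigma> where \<sigma>: "\<sigma> \<in> leibniz_hom K F' G" and \<sigma>_lift: "\<And>y. y \<in> carrier F' \<Longrightarrow> \<phi> (\<sigma> y) = p' y"
    using free_leibniz_projective[OF free G Q h p'] by blast
  interpret \<phi>: nonassoc_hom K G Q \<phi> by (rule nonassoc_homI) fact+
  interpret p: nonassoc_hom K F G p by (rule nonassoc_homI) fact+
  interpret p': nonassoc_hom K F' Q p' by (rule nonassoc_homI) fact+
  interpret \<psi>: nonassoc_hom K F F' \<psi> by (rule nonassoc_homI) fact+
  interpret \<sigma>: nonassoc_hom K F' G \<sigma> by (rule nonassoc_homI) fact+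
  interpret \<sigma>\<psi>: nonassoc_hom K F G "\<lambda>x. \<sigma> (\<psi> x)"
    by (rule nonassoc_homI[OF F G leibniz_hom_comp]) fact+
  have N: "two_sided_ideal K G ?N" by (rule \<phi>.kernel_ideal)
  have C: "submodule ?C K G"
    by (rule \<phi>.P.lie_commutator_submodule) (auto simp: a_kernel_def')
  have D: "submodule ?D K F" by (rule p.P.lie_commutator_submodule) auto
  have C': "submodule ?C' K F'"
    by (rule p'.P.lie_commutator_submodule) (auto simp: a_kernel_def')
  fix x assume x: "x \<in> ?N"
  then obtain f where f: "f \<in> ?D" "x = p f"
    using ker p.lie_commutator_image[OF p(2)] by blast
  have f_car: "f \<in> carrier F" using f p.P.submodule_subset[OF D] by blast
  have "\<psi> f \<in> ?R' \<inter> lie_commutator K F' (carrier F') (carrier F')"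
  proof
    show "\<psi> f \<in> ?R'" using f_car lift x f(2) by (simp add: a_kernel_def')
    show "\<psi> f \<in> lie_commutator K F' (carrier F') (carrier F')"
      by (rule \<psi>.hom_lie_commutator[OF _ _ _ _ _ _ f(1)]) auto
  qed
  then obtain r where r: "r \<in> ?R \<inter> ?D" and "\<exists>c\<in>?C'. \<psi> f = c \<oplus>\<^bsub>F'\<^esub> \<psi> r"
    using HL2_Lie_surj_lift[OF p.P.nonassoc_algebra_axioms p'.P.nonassoc_algebra_axioms
        p.kernel_ideal p'.kernel_ideal epi] by blast
  then obtain c where c: "c \<in> ?C'" "\<psi> f = c \<oplus>\<^bsub>F'\<^esub> \<psi> r" by blast
  have c_car: "c \<in> carrier F'" using c p'.P.submodule_subset[OF C'] by blast
  have r_car: "r \<in> carrier F" "p r = \<zero>\<^bsub>G\<^esub>" using r by (auto simp: a_kernel_def')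
  let ?f = "f \<ominus>\<^bsub>F\<^esub> r"
  have "\<psi> ?f = c"
    unfolding \<psi>.hom_minus[OF f_car r_car(1)] c(2)
    using c_car r_car by (simp add: a_minus_def p'.P.a_assoc p'.P.r_neg)
  moreover have "\<sigma> c \<in> ?C"
    by (rule \<sigma>.hom_lie_commutator[OF _ _ _ _ _ _ c(1)]) (auto simp: a_kernel_def' \<sigma>_lift)
  ultimately have \<sigma>\<psi>: "\<sigma> (\<psi> ?f) \<in> ?C" by simp
  have "p ?f \<ominus>\<^bsub>G\<^esub> \<sigma> (\<psi> ?f) \<in> ?C"
  proof (rule hom_diff_lie_commutator[OF p.nonassoc_hom_axioms \<sigma>\<psi>.nonassoc_hom_axioms N])
    show "?f \<in> ?D" using f r by (intro p.P.submodule_minus[OF D]) auto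
    show "p a \<ominus>\<^bsub>G\<^esub> \<sigma> (\<psi> a) \<in> ?N" if "a \<in> carrier F" for a
      using that lift \<sigma>_lift by (simp add: a_kernel_def' \<phi>.Q.minus_eq_zero_iff)
  qed
  then have "(p ?f \<ominus>\<^bsub>G\<^esub> \<sigma> (\<psi> ?f)) \<oplus>\<^bsub>G\<^esub> \<sigma> (\<psi> ?f) \<in> ?C"
    using \<phi>.P.submodule_add[OF C] \<sigma>\<psi> by blast
  moreover have "(p ?f \<ominus>\<^bsub>G\<^esub> \<sigma> (\<psi> ?f)) \<oplus>\<^bsub>G\<^esub> \<sigma> (\<psi> ?f) = p ?f"
    using f_car r_car
    by (simp add: a_minus_def \<phi>.P.a_assoc \<phi>.P.l_neg del: p.hom_minus \<psi>.hom_minus \<sigma>.hom_minus)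
  moreover have "p ?f = x"
    unfolding p.hom_minus[OF f_car r_car(1)] r_car(2)
    using f(2) f_car by (simp add: a_minus_def)
  ultimately show "x \<in> ?C" by simp
qed

theorem corollary6p3:
  fixes K :: "('k, 'r) ring_scheme"
    and G :: "('k, 'g, 'm) module_scheme" and Q :: "('k, 'q, 'n) module_scheme"
    and F :: "('k, 'e, 'u) module_scheme" and F' :: "('k, 'f, 'v) module_scheme"
    and \<phi> :: "'g \<Rightarrow> 'q" and p :: "'e \<Rightarrow> 'g" and p' :: "'f \<Rightarrow> 'q" and \<psi> :: "'e \<Rightarrow> 'f"
  assumes "field K" and "\<one>\<^bsub>K\<^esub> \<oplus>\<^bsub>K\<^esub> \<one>\<^bsub>K\<^esub> \<in> Units K"
    and "leibniz_algebra K G" and "leibniz_algebra K Q"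
    and "\<phi> \<in> leibniz_hom K G Q"
    and "lie_quot_map K Q \<phi> \<in> leibniz_iso K (lie_quot K G) (lie_quot K Q)"
    and "free_presentation K F p G" and "free_presentation K F' p' Q"
    and "\<psi> \<in> leibniz_hom K F F'" and "\<forall>x\<in>carrier F. p' (\<psi> x) = \<phi> (p x)"
    and "HL2_Lie_map K F' (a_kernel F' Q p') \<psi> \<in>
           leibniz_epi K (HL2_Lie K F (a_kernel F G p)) (HL2_Lie K F' (a_kernel F' Q p'))"
    and "lie_nilpotent K G" and "lie_nilpotent K Q"
  shows "\<phi> \<in> leibniz_iso K G Q"
proof -
  interpret \<phi>: nonassoc_hom K G Q \<phi> by (rule nonassoc_homI) fact+
  have bij: "bij_betw (lie_quot_map K Q \<phi>) (carrier (lie_quot K G)) (carrier (lie_quot K Q))"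
    using assms(6) unfolding leibniz_iso_def by blast
  have onto: "\<phi> ` carrier G = carrier Q"
    by (rule \<phi>.surj_of_lie_quot_surj[OF assms(2,13) bij_betw_imp_surj_on[OF bij]])
  then have epi: "\<phi> \<in> leibniz_epi K G Q"
    using assms(5) unfolding leibniz_epi_def by blast
  have "a_kernel G Q \<phi> \<subseteq> lie_commutator K G (carrier G) (carrier G)"
    using \<phi>.kernel_subset_leib_ann[OF bij_betw_imp_inj_on[OF bij]]
      \<phi>.P.leib_ann_subset_commutator[OF assms(2)] by blast
  then have "a_kernel G Q \<phi> \<subseteq> lie_commutator K G (a_kernel G Q \<phi>) (carrier G)"
    using assms by (intro kernel_subset_commutator_of_HL2_epi[OF assms(3,4) epi assms(7-9) _ assms(11)]) auto
  then have ker: "a_kernel G Q \<phi> \<subseteq> {\<zero>\<^bsub>G\<^esub>}"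
    by (intro \<phi>.P.subset_zero_of_lie_nilpotent[OF assms(12)]) (auto simp: a_kernel_def')
  have "inj_on \<phi> (carrier G)"
  proof (rule inj_onI)
    fix x y assume xy: "x \<in> carrier G" "y \<in> carrier G" "\<phi> x = \<phi> y"
    then have "x \<ominus>\<^bsub>G\<^esub> y \<in> a_kernel G Q \<phi>"
      by (simp add: a_kernel_def' \<phi>.Q.minus_eq_zero_iff)
    then show "x = y" using ker xy by (auto simp: \<phi>.P.minus_eq_zero_iff)
  qed
  then show ?thesis
    using onto assms(5) unfolding leibniz_iso_def bij_betw_def by blast
qed

end
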